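(* For every integer $N>0$ there is an action of the free group $F_2$ of rank $2$ on a reduced tree which is $1$-acylindrical on the non-cyclic subgroups of $F_2$ and has exactly $N$ orbits of edges.
   Context: Groups act on (simplicial) trees by automorphisms without inversions. An action is minimal if there is no proper invariant subtree. An action of $G$ on a tree $T$ is $k$-acylindrical on a conjugation-closed class $\mathcal{Q}$ of subgroups if whenever some $H\in\mathcal{Q}$ fixes every edge of a reduced edge path $p$, then $p$ contains at most $k$ edges. A tree $T$ with $G$-action is reduced if the action is minimal and either (i) $T/G$ is a circle consisting of a single vertex and a single edge; or (ii) whenever a vertex $v$ of $T$ has stabiliser equal to the stabiliser of an edge of $T$, the image of $v$ in $T/G$ has valence at least $3$ in $T/G$. *)

theory Defs
  imports "HOL-Algebra.Algebra"
begin

section \<open>Free groups\<close>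

text \<open>The free group on a set \<open>S\<close>, as the group of reduced words. The letter \<open>(s, True)\<close> stands
  for the generator \<open>s\<close> and \<open>(s, False)\<close> for its inverse.\<close>

type_synonym 'a word = "('a \<times> bool) list"

definition inverse_letters :: "'a \<times> bool \<Rightarrow> 'a \<times> bool \<Rightarrow> bool" where
  "inverse_letters x y \<longleftrightarrow> fst x = fst y \<and> snd x \<noteq> snd y"

definition reduced_word :: "'a word \<Rightarrow> bool" where
  "reduced_word w \<longleftrightarrow> successively (\<lambda>x y. \<not> inverse_letters x y) w"

fun cons_reduce :: "'a \<times> bool \<Rightarrow> 'a word \<Rightarrow> 'a word" where
  "cons_reduce x [] = [x]"
| "cons_reduce x (y # w) = (if inverse_letters x y then w else x # y # w)"

definition free_group :: "'a set \<Rightarrow> 'a word monoid" where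
  "free_group S =
     \<lparr>carrier = {w. reduced_word w \<and> fst ` set w \<subseteq> S},
      monoid.mult = (\<lambda>v w. foldr cons_reduce v w),
      one = []\<rparr>"

abbreviation F2 :: "nat word monoid" where
  "F2 \<equiv> free_group {0, 1}"

lemma reduced_word_cons_reduce: "reduced_word w \<Longrightarrow> reduced_word (cons_reduce x w)"
  by (cases w rule: remdups_adj.cases) (auto simp: reduced_word_def)

lemma reduced_word_foldr: "reduced_word w \<Longrightarrow> reduced_word (foldr cons_reduce v w)"
  by (induction v) (auto intro: reduced_word_cons_reduce)

lemma set_cons_reduce: "set (cons_reduce x w) \<subseteq> insert x (set w)"
  by (cases w) auto

lemma set_foldr_cons_reduce: "set (foldr cons_reduce v w) \<subseteq> set v \<union> set w"
proof (induction v)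
  case (Cons x v)
  then show ?case using set_cons_reduce[of x "foldr cons_reduce v w"] by auto
qed auto

lemma cons_reduce_cancel:
  assumes "reduced_word w" "inverse_letters x y"
  shows "cons_reduce x (cons_reduce y w) = w"
proof (cases w)
  case Nil
  then show ?thesis using assms by simp
next
  case (Cons z v)
  show ?thesis
  proof (cases "inverse_letters y z")
    case True
    then have "z = x" using assms(2) by (auto simp: inverse_letters_def prod_eq_iff)
    then show ?thesis using True Cons assms(1)
      by (cases v) (auto simp: reduced_word_def)
  qed (use Cons assms in auto)
qed

lemma foldr_cons_reduce_cons_reduce:
  "reduced_word w \<Longrightarrow> foldr cons_reduce (cons_reduce x v) w = cons_reduce x (foldr cons_reduce v w)"
  by (cases v) (auto simp: cons_reduce_cancel reduced_word_foldr)

lemma foldr_cons_reduce_assoc: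
  "reduced_word w \<Longrightarrow>
     foldr cons_reduce (foldr cons_reduce u v) w = foldr cons_reduce u (foldr cons_reduce v w)"
  by (induction u) (auto simp: foldr_cons_reduce_cons_reduce)

lemma foldr_cons_reduce_Nil: "reduced_word w \<Longrightarrow> foldr cons_reduce w [] = w"
proof (induction w)
  case (Cons x w)
  then show ?case by (cases w) (auto simp: reduced_word_def)
qed simp

lemma foldr_cons_reduce_inverse:
  "foldr cons_reduce (rev (map (\<lambda>(s, e). (s, \<not> e)) w)) (foldr cons_reduce w []) = []"
proof (induction w)
  case (Cons x w)
  have "reduced_word (foldr cons_reduce w [])"
    by (rule reduced_word_foldr) (simp add: reduced_word_def)
  moreover have "inverse_letters (case x of (s, e) \<Rightarrow> (s, \<not> e)) x"
    by (auto simp: inverse_letters_def split: prod.splits)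
  ultimately show ?case using Cons by (simp add: cons_reduce_cancel)
qed simp

lemma group_free_group: "group (free_group S)"
proof (rule groupI)
  fix x assume x: "x \<in> carrier (free_group S)"
  define y where "y = rev (map (\<lambda>(s, e). (s, \<not> e)) x)"
  define z where "z = foldr cons_reduce y []"
  have z: "reduced_word z"
    unfolding z_def by (rule reduced_word_foldr) (simp add: reduced_word_def)
  have "fst ` set y = fst ` set x"
    by (force simp: y_def image_iff)
  then have "fst ` set z \<subseteq> S"
    using x set_foldr_cons_reduce[of y "[]"] by (auto simp: z_def free_group_def)
  moreover have "foldr cons_reduce z x = []"
    using x foldr_cons_reduce_assoc[of x y "[]"] foldr_cons_reduce_inverse[of x]
    by (simp add: z_def y_def free_group_def foldr_cons_reduce_Nil)
  ultimately show "\<exists>y\<in>carrier (free_group S). y \<otimes>\<^bsub>free_group S\<^esub> x = \<one>\<^bsub>free_group S\<^esub>"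
    using z by (intro bexI[of _ z]) (auto simp: free_group_def)
next
  fix x y assume "x \<in> carrier (free_group S)" "y \<in> carrier (free_group S)"
  then have "reduced_word y" and S: "fst ` (set x \<union> set y) \<subseteq> S"
    by (auto simp: free_group_def)
  moreover have "fst ` set (foldr cons_reduce x y) \<subseteq> S"
    using image_mono[OF set_foldr_cons_reduce[of x y], of fst] S by (rule subset_trans)
  ultimately show "x \<otimes>\<^bsub>free_group S\<^esub> y \<in> carrier (free_group S)"
    by (simp add: free_group_def reduced_word_foldr)
qed (auto simp: free_group_def foldr_cons_reduce_assoc reduced_word_def)


section \<open>Simplicial trees\<close>

text \<open>A simplicial graph is given by its vertex set and its set of edges, an edge being the set of
  its two endpoints. An edge path is the nonempty list of its successive vertices, so that a path
  \<open>p\<close> has \<open>length p - 1\<close> edges.\<close>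

definition is_graph :: "'v set \<Rightarrow> 'v set set \<Rightarrow> bool" where
  "is_graph V E \<longleftrightarrow> E \<subseteq> {{u, v} |u v. u \<in> V \<and> v \<in> V \<and> u \<noteq> v}"

definition edge_path :: "'v set \<Rightarrow> 'v set set \<Rightarrow> 'v list \<Rightarrow> bool" where
  "edge_path V E p \<longleftrightarrow> p \<noteq> [] \<and> set p \<subseteq> V \<and> successively (\<lambda>u v. {u, v} \<in> E) p"

definition reduced_edge_path :: "'v set \<Rightarrow> 'v set set \<Rightarrow> 'v list \<Rightarrow> bool" where
  "reduced_edge_path V E p \<longleftrightarrow>
     edge_path V E p \<and> (\<forall>i. i + 2 < length p \<longrightarrow> p ! i \<noteq> p ! (i + 2))"

definition is_tree :: "'v set \<Rightarrow> 'v set set \<Rightarrow> bool" where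
  "is_tree V E \<longleftrightarrow> is_graph V E \<and> V \<noteq> {} \<and>
     (\<forall>u\<in>V. \<forall>v\<in>V. \<exists>p. edge_path V E p \<and> hd p = u \<and> last p = v) \<and>
     \<not> (\<exists>p. reduced_edge_path V E p \<and> length p > 1 \<and> hd p = last p)"

definition is_subtree :: "'v set \<Rightarrow> 'v set set \<Rightarrow> 'v set \<Rightarrow> 'v set set \<Rightarrow> bool" where
  "is_subtree V' E' V E \<longleftrightarrow> V' \<subseteq> V \<and> E' \<subseteq> E \<and> is_tree V' E'"


section \<open>Group actions on trees\<close>

text \<open>An action is given by its effect \<open>\<phi>\<close> on vertices; \<open>g\<close> sends an edge \<open>e\<close> to \<open>\<phi> g ` e\<close>.
  A tree on which a countable group acts with finitely many orbits of edges has countably many vertices,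
  so for such actions the vertices may be taken to be natural numbers.\<close>

definition edge_act :: "('g \<Rightarrow> 'v \<Rightarrow> 'v) \<Rightarrow> 'g \<Rightarrow> 'v set \<Rightarrow> 'v set" where
  "edge_act \<phi> g e = \<phi> g ` e"

definition tree_action ::
  "('g, 'm) monoid_scheme \<Rightarrow> 'v set \<Rightarrow> 'v set set \<Rightarrow> ('g \<Rightarrow> 'v \<Rightarrow> 'v) \<Rightarrow> bool" where
  "tree_action G V E \<phi> \<longleftrightarrow> is_tree V E \<and> group_action G V \<phi> \<and>
     (\<forall>g\<in>carrier G. \<forall>e\<in>E. edge_act \<phi> g e \<in> E) \<and>
     (\<forall>g\<in>carrier G. \<forall>u v. {u, v} \<in> E \<longrightarrow> \<not> (\<phi> g u = v \<and> \<phi> g v = u))"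

definition minimal_action ::
  "('g, 'm) monoid_scheme \<Rightarrow> 'v set \<Rightarrow> 'v set set \<Rightarrow> ('g \<Rightarrow> 'v \<Rightarrow> 'v) \<Rightarrow> bool" where
  "minimal_action G V E \<phi> \<longleftrightarrow>
     (\<forall>V' E'. is_subtree V' E' V E \<and>
        (\<forall>g\<in>carrier G. \<phi> g ` V' \<subseteq> V' \<and> edge_act \<phi> g ` E' \<subseteq> E') \<longrightarrow> V' = V \<and> E' = E)"

abbreviation vertex_orbits ::
  "('g, 'm) monoid_scheme \<Rightarrow> 'v set \<Rightarrow> ('g \<Rightarrow> 'v \<Rightarrow> 'v) \<Rightarrow> 'v set set" where
  "vertex_orbits G V \<phi> \<equiv> orbits G V \<phi>"

abbreviation edge_orbits ::
  "('g, 'm) monoid_scheme \<Rightarrow> 'v set set \<Rightarrow> ('g \<Rightarrow> 'v \<Rightarrow> 'v) \<Rightarrow> 'v set set set" where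
  "edge_orbits G E \<phi> \<equiv> orbits G E (edge_act \<phi>)"

text \<open>The oriented edges of the quotient graph that start at the image of the vertex \<open>v\<close>. As there
  are no inversions, the two orientations of an edge lie in different orbits, so a loop of the
  quotient at the image of \<open>v\<close> contributes two elements, as it should for the valence.\<close>

definition quotient_star ::
  "('g, 'm) monoid_scheme \<Rightarrow> 'v set set \<Rightarrow> ('g \<Rightarrow> 'v \<Rightarrow> 'v) \<Rightarrow> 'v \<Rightarrow> ('v \<times> 'v) set set" where
  "quotient_star G E \<phi> v =
     orbits G {(u, w). u \<in> orbit G \<phi> v \<and> {u, w} \<in> E} (\<lambda>g. map_prod (\<phi> g) (\<phi> g))"

definition quotient_valence_ge ::
  "('g, 'm) monoid_scheme \<Rightarrow> 'v set set \<Rightarrow> ('g \<Rightarrow> 'v \<Rightarrow> 'v) \<Rightarrow> 'v \<Rightarrow> nat \<Rightarrow> bool" where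
  "quotient_valence_ge G E \<phi> v n \<longleftrightarrow>
     infinite (quotient_star G E \<phi> v) \<or> n \<le> card (quotient_star G E \<phi> v)"

definition reduced_tree ::
  "('g, 'm) monoid_scheme \<Rightarrow> 'v set \<Rightarrow> 'v set set \<Rightarrow> ('g \<Rightarrow> 'v \<Rightarrow> 'v) \<Rightarrow> bool" where
  "reduced_tree G V E \<phi> \<longleftrightarrow> minimal_action G V E \<phi> \<and>
     (card (vertex_orbits G V \<phi>) = 1 \<and> card (edge_orbits G E \<phi>) = 1 \<or>
      (\<forall>v\<in>V. (\<exists>e\<in>E. stabilizer G \<phi> v = stabilizer G (edge_act \<phi>) e) \<longrightarrow>
         quotient_valence_ge G E \<phi> v 3))"

definition acylindrical_on ::
  "'v set \<Rightarrow> 'v set set \<Rightarrow> ('g \<Rightarrow> 'v \<Rightarrow> 'v) \<Rightarrow> nat \<Rightarrow> 'g set set \<Rightarrow> bool" where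
  "acylindrical_on V E \<phi> k Q \<longleftrightarrow>
     (\<forall>H\<in>Q. \<forall>p. reduced_edge_path V E p \<and>
        (\<forall>i. Suc i < length p \<longrightarrow> (\<forall>h\<in>H. edge_act \<phi> h {p ! i, p ! Suc i} = {p ! i, p ! Suc i})) \<longrightarrow>
        length p - 1 \<le> k)"

definition noncyclic_subgroups :: "('g, 'm) monoid_scheme \<Rightarrow> 'g set set" where
  "noncyclic_subgroups G = {H. subgroup H G \<and> \<not> cyclic_group (G\<lparr>carrier := H\<rparr>)}"

text \<open>Acylindricity is meant for conjugation-closed classes of subgroups; this is one.\<close>

lemma noncyclic_subgroups_conjugation_closed:
  assumes "group G" "H \<in> noncyclic_subgroups G" "g \<in> carrier G"
  shows "g <#\<^bsub>G\<^esub> H #>\<^bsub>G\<^esub> inv\<^bsub>G\<^esub> g \<in> noncyclic_subgroups G"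
proof -
  interpret group G by fact
  let ?K = "g <#\<^bsub>G\<^esub> H #>\<^bsub>G\<^esub> inv\<^bsub>G\<^esub> g"
  have H: "subgroup H G" and Hc: "\<not> cyclic_group (G\<lparr>carrier := H\<rparr>)"
    using assms by (auto simp: noncyclic_subgroups_def)
  have K: "subgroup ?K G"
    by (rule subgroup_conjugation_is_surj2[OF assms(3) H])
  have sub: "H \<subseteq> carrier G" using H by (rule subgroup.subset)
  have image: "?K = (\<lambda>h. g \<otimes>\<^bsub>G\<^esub> h \<otimes>\<^bsub>G\<^esub> inv\<^bsub>G\<^esub> g) ` H"
    by (auto simp: l_coset_def r_coset_def)
  have "(\<lambda>h. g \<otimes>\<^bsub>G\<^esub> h \<otimes>\<^bsub>G\<^esub> inv\<^bsub>G\<^esub> g) \<in> iso (G\<lparr>carrier := H\<rparr>) (G\<lparr>carrier := ?K\<rparr>)"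
    unfolding iso_iff
  proof (intro conjI)
    show "(\<lambda>h. g \<otimes>\<^bsub>G\<^esub> h \<otimes>\<^bsub>G\<^esub> inv\<^bsub>G\<^esub> g) \<in> hom (G\<lparr>carrier := H\<rparr>) (G\<lparr>carrier := ?K\<rparr>)"
    proof (rule homI)
      fix x y
      assume "x \<in> carrier (G\<lparr>carrier := H\<rparr>)" "y \<in> carrier (G\<lparr>carrier := H\<rparr>)"
      then have xy: "x \<in> carrier G" "y \<in> carrier G" using sub by auto
      have "g \<otimes>\<^bsub>G\<^esub> (x \<otimes>\<^bsub>G\<^esub> y) \<otimes>\<^bsub>G\<^esub> inv\<^bsub>G\<^esub> g =
          g \<otimes>\<^bsub>G\<^esub> x \<otimes>\<^bsub>G\<^esub> inv\<^bsub>G\<^esub> g \<otimes>\<^bsub>G\<^esub> (g \<otimes>\<^bsub>G\<^esub> y \<otimes>\<^bsub>G\<^esub> inv\<^bsub>G\<^esub> g)"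
        using xy assms(3) by (smt (verit) inv_closed l_inv l_one m_assoc m_closed)
      then show "g \<otimes>\<^bsub>G\<^esub> (x \<otimes>\<^bsub>G\<lparr>carrier := H\<rparr>\<^esub> y) \<otimes>\<^bsub>G\<^esub> inv\<^bsub>G\<^esub> g =
          g \<otimes>\<^bsub>G\<^esub> x \<otimes>\<^bsub>G\<^esub> inv\<^bsub>G\<^esub> g \<otimes>\<^bsub>G\<lparr>carrier := ?K\<rparr>\<^esub> (g \<otimes>\<^bsub>G\<^esub> y \<otimes>\<^bsub>G\<^esub> inv\<^bsub>G\<^esub> g)"
        by simp
    qed (auto simp: image)
    show "inj_on (\<lambda>h. g \<otimes>\<^bsub>G\<^esub> h \<otimes>\<^bsub>G\<^esub> inv\<^bsub>G\<^esub> g) (carrier (G\<lparr>carrier := H\<rparr>))"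
      using sub assms(3) by (auto simp: inj_on_def subset_iff)
  qed (simp add: image)
  then have "(G\<lparr>carrier := H\<rparr>) \<cong> (G\<lparr>carrier := ?K\<rparr>)" by (rule is_isoI)
  then show ?thesis
    using isomorphic_group_cyclicity[OF _ subgroup_imp_group[OF H] subgroup_imp_group[OF K]] K Hc
    by (simp add: noncyclic_subgroups_def)
qed

end

theory Submission
  imports Defs "HOL-Library.Countable"
begin

text \<open>
  Let \<open>a, b\<close> be the generators of \<open>F2\<close>. Put \<open>w\<^sub>0 = b\<close> and \<open>w\<^sub>k\<^sub>+\<^sub>1 = w\<^sub>k x\<^sub>k w\<^sub>k\<close> with \<open>x\<^sub>k = a ^ (2 ^ (N - k))\<close>, and
  consider the segment of groups with vertex groups \<open>A\<^sub>k\<close> generated by \<open>x\<^sub>k, w\<^sub>k\<close>, for \<open>k = 0, \<dots>, N\<close>, and edge groups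
  \<open>C\<^sub>k\<close> generated by \<open>x\<^sub>k, w\<^sub>k\<^sub>+\<^sub>1\<close> for \<open>k < N\<close>. As \<open>x\<^sub>k = x\<^sub>k\<^sub>+\<^sub>1\<^sup>2\<close>, the group \<open>C\<^sub>k\<close> lies in \<open>A\<^sub>k\<close> and in \<open>A\<^sub>k\<^sub>+\<^sub>1\<close>. The tree is
  the coset tree of this segment; it has \<open>N\<close> orbits of edges by construction.

  The coset graph is a tree because \<open>F2\<close> splits along every \<open>C\<^sub>k\<close> (lemma \<open>edge_halves\<close>). Indeed \<open>F2\<close> is the amalgamated
  product of the powers of \<open>a\<close> with the subgroup \<open>H\<close> generated by \<open>x\<^sub>k, b\<close>, along the powers of \<open>x\<^sub>k\<close>. For any \<open>C\<close> with
  \<open>x\<^sub>k \<in> C \<subseteq> H\<close>, folding the edges at the vertex of \<open>H\<close> turns this into a splitting over \<open>C\<close> with vertex groups \<open>H\<close> and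
  the subgroup generated by \<open>a\<close> and \<open>C\<close>. For \<open>C = C\<^sub>k\<close> these contain \<open>A\<^sub>0, \<dots>, A\<^sub>k\<close> and \<open>A\<^sub>k\<^sub>+\<^sub>1, \<dots>, A\<^sub>N\<close>, respectively. So
  every edge of the coset graph is a bridge, and a connected graph of bridges is a tree
  (\<open>no_reduced_closed_path_if_bridges\<close>).

  Each \<open>A\<^sub>k\<close> is free on \<open>x = x\<^sub>k\<close> and \<open>y = w\<^sub>k\<close>, because \<open>w\<^sub>k\<close> is a positive word that begins and ends with \<open>b\<close>
  (\<open>lift_framed\<close>), and the two kinds of edge groups in it are those generated by \<open>x, yxy\<close> and by \<open>x\<^sup>2, y\<close>, whatever \<open>k\<close> is.
  A group that fixes two distinct edges at a vertex is therefore, up to conjugation, contained in an intersection of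
  conjugates of these two subgroups of a free group of rank two. Such intersections are described by the loops in
  products of their Stallings graphs, which have three and two vertices. The relevant components of these products contain at most
  one cycle, and its label has nonzero exponent sum. Hence the exponent sum embeds the intersection in the integers, and it is
  cyclic (\<open>edges_meet_in_cyclic_groups\<close>): noncyclic subgroups fix paths of at most one edge.

  Minimality and reducedness follow from the exponent sums in \<open>a\<close> and in \<open>b\<close>: those of \<open>A\<^sub>k\<close> generate the multiples of \<open>2 ^ (N - k)\<close>
  and of \<open>2 ^ k\<close>. So no conjugate of a vertex group is an edge stabiliser, and neither side of an edge of the segment generates \<open>F2\<close>.
\<close>

section \<open>Graphs all of whose edges are bridges\<close>

text \<open>A shortest closed piece of a reduced path runs through each of its edges once, so it cannot come
  back to the side of its first edge on which it started. A bridge is recorded as a two-colouring of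
  the vertices that changes exactly across it; such colourings are easy to write down for coset graphs.\<close>
lemma no_reduced_closed_path_if_bridges:
  assumes bridge: "\<And>e. e \<in> E \<Longrightarrow> \<exists>\<chi>::'v \<Rightarrow> bool. \<forall>u v. {u, v} \<in> E \<longrightarrow> (\<chi> u \<noteq> \<chi> v \<longleftrightarrow> {u, v} = e)"
  shows "\<not> (\<exists>p. reduced_edge_path V E p \<and> length p > 1 \<and> hd p = last p)"
proof
  assume "\<exists>p. reduced_edge_path V E p \<and> length p > 1 \<and> hd p = last p"
  then obtain p where p: "reduced_edge_path V E p" "length p > 1" "hd p = last p" by blast
  have edge: "{p ! k, p ! Suc k} \<in> E" if "Suc k < length p" for k
    using p(1) that successively_nth[of "\<lambda>u v. {u, v} \<in> E" p k]
    by (simp add: reduced_edge_path_def edge_path_def)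
  define returns where "returns d \<longleftrightarrow> d > 0 \<and> (\<exists>i. i + d < length p \<and> p ! i = p ! (i + d))" for d
  have "returns (length p - 1)"
    using p(2,3) unfolding returns_def
    by (intro conjI exI[of _ 0]) (cases p; simp add: last_conv_nth)+
  then obtain d where "returns d" and least: "\<And>m. m < d \<Longrightarrow> \<not> returns m"
    using exists_least_iff[of returns] by blast
  then obtain i where d: "d > 0" "i + d < length p" "p ! i = p ! (i + d)"
    unfolding returns_def by blast
  have distinct: "p ! k \<noteq> p ! l" if "i \<le> k" "k < l" "l \<le> i + d" "l - k < d" for k l
  proof
    assume "p ! k = p ! l"
    then have "l - k > 0 \<and> k + (l - k) < length p \<and> p ! k = p ! (k + (l - k))"
      using that(2,3) d(2) by simp
    then have "returns (l - k)" unfolding returns_def by blast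
    then show False using that(4) least by simp
  qed
  have i: "Suc i < length p" using d(1,2) by simp
  from bridge[OF edge[OF i]] obtain \<chi> :: "'v \<Rightarrow> bool" where
    "\<forall>u v. {u, v} \<in> E \<longrightarrow> (\<chi> u \<noteq> \<chi> v \<longleftrightarrow> {u, v} = {p ! i, p ! Suc i})" ..
  then have \<chi>: "\<chi> u \<noteq> \<chi> v \<longleftrightarrow> {u, v} = {p ! i, p ! Suc i}" if "{u, v} \<in> E" for u v
    using that by blast
  have again: "\<chi> (p ! Suc k) = \<chi> (p ! k)" if k: "Suc i \<le> k" "k < i + d" for k
  proof (rule ccontr)
    assume "\<chi> (p ! Suc k) \<noteq> \<chi> (p ! k)"
    then have "{p ! k, p ! Suc k} = {p ! i, p ! Suc i}" using \<chi>[OF edge[of k]] k d(2) by auto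
    moreover have "p ! i \<noteq> p ! k" using distinct[of i k] k by auto
    ultimately have eq: "p ! k = p ! Suc i" "p ! Suc k = p ! i" by (auto simp: doubleton_eq_iff)
    moreover have "k - Suc i < d" using k d(1) by simp
    ultimately have "k = Suc i" using distinct[of "Suc i" k] k by force
    moreover have "p ! i \<noteq> p ! (i + 2)" if "i + 2 < length p"
      using p(1) that unfolding reduced_edge_path_def by blast
    ultimately show False using eq(2) k d(2) by simp
  qed
  have "\<chi> (p ! (Suc i + m)) = \<chi> (p ! Suc i)" if "Suc m \<le> d" for m
    using that
  proof (induction m)
    case (Suc m)
    then show ?case using again[of "Suc i + m"] by simp
  qed simp
  from this[of "d - 1"] have "\<chi> (p ! (i + d)) = \<chi> (p ! Suc i)" using d(1) by simp
  then have "\<chi> (p ! i) = \<chi> (p ! Suc i)" unfolding d(3)[symmetric] .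
  then show False using \<chi>[OF edge[OF i]] by simp
qed

lemma edge_path_if_rtranclp:
  assumes "is_graph V E" "(\<lambda>u v. {u, v} \<in> E)\<^sup>*\<^sup>* u v" "u \<in> V"
  shows "\<exists>p. edge_path V E p \<and> hd p = u \<and> last p = v"
  using assms(2)
proof induction
  case base
  then show ?case using assms(3) by (intro exI[of _ "[u]"]) (auto simp: edge_path_def)
next
  case (step v w)
  then obtain p where p: "edge_path V E p" "hd p = u" "last p = v" by blast
  have "w \<in> V" using step(2) assms(1) by (auto simp: is_graph_def doubleton_eq_iff)
  then show ?case using p step(2)
    by (intro exI[of _ "p @ [w]"]) (auto simp: edge_path_def successively_append_iff)
qed

lemma rtranclp_if_edge_path:
  "edge_path V E p \<Longrightarrow> (\<lambda>u v. {u, v} \<in> E)\<^sup>*\<^sup>* (hd p) (last p)"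
proof (induction p rule: induct_list012)
  case (3 x y zs)
  then have "(\<lambda>u v. {u, v} \<in> E)\<^sup>*\<^sup>* y (last (y # zs))" "{x, y} \<in> E"
    by (auto simp: edge_path_def)
  then show ?case by (auto intro: converse_rtranclp_into_rtranclp)
qed (auto simp: edge_path_def)

lemma (in group) inv_cancel_left [simp]:
  assumes "g \<in> carrier G" "h \<in> carrier G"
  shows "inv g \<otimes> (g \<otimes> h) = h" "g \<otimes> (inv g \<otimes> h) = h"
  using assms by (simp_all flip: m_assoc)

section \<open>Coset trees of chains of subgroups\<close>

text \<open>Membership in a right invariant set only depends on the coset \<open>g K\<close>, hence colours the vertices
  that are cosets of \<open>K\<close>.\<close>
definition right_invariant :: "('g, 'm) monoid_scheme \<Rightarrow> 'g set \<Rightarrow> 'g set \<Rightarrow> bool" where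
  "right_invariant G S K \<longleftrightarrow> (\<forall>g\<in>carrier G. \<forall>h\<in>K. g \<otimes>\<^bsub>G\<^esub> h \<in> S \<longleftrightarrow> g \<in> S)"

text \<open>A segment of groups \<open>A 0, \<dots>, A N\<close> with edge groups \<open>C i\<close>, realised inside \<open>G\<close>. Its coset graph has
  the cosets \<open>g A i\<close> as vertices and the cosets \<open>g C i\<close> as edges from \<open>g A i\<close> to \<open>g A (i + 1)\<close>. The
  vertices are given by an arbitrary encoding \<open>vtx\<close> of the cosets, so that they can be natural numbers.

  The last assumption says that the base edge of index \<open>i\<close> is a bridge: colour the vertices of index
  at most \<open>i\<close> by \<open>S\<close> and those of larger index by \<open>T\<close>. Endpoints of an edge of another index get the same
  colour because they share an element and the same set is used for both, and the endpoints of
  \<open>g C i\<close> get different colours only if \<open>g C i = C i\<close>. Together with the generation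
  of \<open>G\<close> by the vertex groups this makes \<open>G\<close> the amalgamated product along \<open>C i\<close>
  of the subgroups generated by the vertex groups on the two sides.\<close>
locale subgroup_chain = group G for G :: "('g, 'm) monoid_scheme" (structure) +
  fixes N :: nat and A C :: "nat \<Rightarrow> 'g set" and vtx :: "nat \<Rightarrow> 'g \<Rightarrow> 'v"
  assumes subgroup_A: "i \<le> N \<Longrightarrow> subgroup (A i) G"
    and subgroup_C: "i < N \<Longrightarrow> subgroup (C i) G"
    and C_le: "i < N \<Longrightarrow> C i \<subseteq> A i \<inter> A (Suc i)"
    and vtx_eq_iff: "\<lbrakk>i \<le> N; j \<le> N; g \<in> carrier G; h \<in> carrier G\<rbrakk> \<Longrightarrow>
           vtx i g = vtx j h \<longleftrightarrow> i = j \<and> inv g \<otimes> h \<in> A i"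
    and generates: "carrier G \<subseteq> generate G (\<Union>i\<le>N. A i)"
    and separated: "i < N \<Longrightarrow> \<exists>S T.
           (\<forall>j\<le>i. right_invariant G S (A j)) \<and> (\<forall>j\<in>{i<..N}. right_invariant G T (A j)) \<and>
           (\<forall>g\<in>carrier G. (g \<in> S) \<noteq> (g \<in> T) \<longleftrightarrow> g \<in> C i)"
begin

lemma A_in_carrier: "i \<le> N \<Longrightarrow> h \<in> A i \<Longrightarrow> h \<in> carrier G"
  using subgroup.mem_carrier[OF subgroup_A] .

lemma A_inv: "i \<le> N \<Longrightarrow> g \<in> A i \<Longrightarrow> inv g \<in> A i"
  using subgroup.m_inv_closed[OF subgroup_A] .

lemma A_sym:
  assumes "i \<le> N" "g \<in> carrier G" "h \<in> carrier G" "inv g \<otimes> h \<in> A i"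
  shows "inv h \<otimes> g \<in> A i"
  using A_inv[OF assms(1,4)] assms(2,3) by (simp add: inv_mult_group)

lemma A_int_A_Suc:
  assumes "i < N"
  shows "A i \<inter> A (Suc i) = C i"
proof
  obtain S T where "\<forall>j\<le>i. right_invariant G S (A j)" "\<forall>j\<in>{i<..N}. right_invariant G T (A j)"
    and cut: "\<forall>g\<in>carrier G. (g \<in> S) \<noteq> (g \<in> T) \<longleftrightarrow> g \<in> C i"
    using separated[OF assms] by blast
  then have S: "\<And>j g h. j \<le> i \<Longrightarrow> g \<in> carrier G \<Longrightarrow> h \<in> A j \<Longrightarrow> g \<otimes> h \<in> S \<longleftrightarrow> g \<in> S"
    and T: "\<And>j g h. i < j \<Longrightarrow> j \<le> N \<Longrightarrow> g \<in> carrier G \<Longrightarrow> h \<in> A j \<Longrightarrow> g \<otimes> h \<in> T \<longleftrightarrow> g \<in> T"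
    by (auto simp: right_invariant_def)
  show "A i \<inter> A (Suc i) \<subseteq> C i"
  proof
    fix h assume h: "h \<in> A i \<inter> A (Suc i)"
    then have hc: "h \<in> carrier G" using A_in_carrier[of i h] assms by auto
    have "h \<in> S \<longleftrightarrow> \<one> \<in> S" "h \<in> T \<longleftrightarrow> \<one> \<in> T"
      using S[of i \<one> h] T[of "Suc i" \<one> h] h hc assms by auto
    moreover have "\<one> \<in> C i" using subgroup_C assms by (simp add: subgroup.one_closed)
    ultimately show "h \<in> C i" using cut hc by auto
  qed
qed (use C_le assms in auto)

definition V :: "'v set" where
  "V = {vtx i g | i g. i \<le> N \<and> g \<in> carrier G}"

definition edge :: "nat \<Rightarrow> 'g \<Rightarrow> 'v set" where
  "edge i g = {vtx i g, vtx (Suc i) g}"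

definition E :: "'v set set" where
  "E = {edge i g | i g. i < N \<and> g \<in> carrier G}"

definition act :: "'g \<Rightarrow> 'v \<Rightarrow> 'v" where
  "act g = (\<lambda>v\<in>V. THE u. \<exists>i h. i \<le> N \<and> h \<in> carrier G \<and> v = vtx i h \<and> u = vtx i (g \<otimes> h))"

lemma vtx_in_V [intro]: "i \<le> N \<Longrightarrow> g \<in> carrier G \<Longrightarrow> vtx i g \<in> V"
  by (auto simp: V_def)

lemma edge_in_E [intro]: "i < N \<Longrightarrow> g \<in> carrier G \<Longrightarrow> edge i g \<in> E"
  by (auto simp: E_def)

lemma inv_mult_mult:
  assumes "g \<in> carrier G" "h \<in> carrier G" "k \<in> carrier G"
  shows "inv (g \<otimes> h) \<otimes> (g \<otimes> k) = inv h \<otimes> k"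
  using assms by (simp add: inv_mult_group m_assoc)

lemma act_vtx:
  assumes "g \<in> carrier G" "h \<in> carrier G" "i \<le> N"
  shows "act g (vtx i h) = vtx i (g \<otimes> h)"
proof -
  have "(THE u. \<exists>j k. j \<le> N \<and> k \<in> carrier G \<and> vtx i h = vtx j k \<and> u = vtx j (g \<otimes> k)) = vtx i (g \<otimes> h)"
  proof (rule the_equality)
    fix u assume "\<exists>j k. j \<le> N \<and> k \<in> carrier G \<and> vtx i h = vtx j k \<and> u = vtx j (g \<otimes> k)"
    then obtain j k where k: "k \<in> carrier G" "j \<le> N" "vtx i h = vtx j k" and u: "u = vtx j (g \<otimes> k)" by blast
    have "i = j" "inv h \<otimes> k \<in> A i" using vtx_eq_iff[of i j h k] k assms by auto
    then show "u = vtx i (g \<otimes> h)"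
      using vtx_eq_iff[of i i "g \<otimes> k" "g \<otimes> h"] u assms k(1) A_sym[of i h k] by (simp add: inv_mult_mult)
  qed (use assms in blast)
  then show ?thesis using assms by (auto simp: act_def)
qed

lemma edge_act_edge:
  assumes "g \<in> carrier G" "h \<in> carrier G" "i < N"
  shows "edge_act act g (edge i h) = edge i (g \<otimes> h)"
  using assms by (simp add: edge_act_def edge_def act_vtx)

lemma vtx_neq: "i \<le> N \<Longrightarrow> j \<le> N \<Longrightarrow> i \<noteq> j \<Longrightarrow> g \<in> carrier G \<Longrightarrow> h \<in> carrier G \<Longrightarrow> vtx i g \<noteq> vtx j h"
  by (simp add: vtx_eq_iff)

lemma edge_eq_iff:
  assumes "i < N" "j < N" "g \<in> carrier G" "h \<in> carrier G"
  shows "edge i g = edge j h \<longleftrightarrow> i = j \<and> inv g \<otimes> h \<in> C i"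
proof -
  have "edge i g = edge j h \<longleftrightarrow> i = j \<and> inv g \<otimes> h \<in> A i \<inter> A (Suc i)"
    using assms by (auto simp: edge_def doubleton_eq_iff vtx_eq_iff)
  then show ?thesis using A_int_A_Suc[OF assms(1)] by auto
qed

lemma edgeE:
  assumes "{u, v} \<in> E"
  obtains i g where "i < N" "g \<in> carrier G"
    "u = vtx i g \<and> v = vtx (Suc i) g \<or> u = vtx (Suc i) g \<and> v = vtx i g"
  using assms by (auto simp: E_def edge_def doubleton_eq_iff)

lemma is_graph: "is_graph V E"
  unfolding is_graph_def E_def edge_def using vtx_in_V vtx_neq
  by (smt (verit, best) Collect_mono Suc_leI less_imp_le n_not_Suc_n)

lemma edge_is_bridge:
  assumes "e \<in> E"
  shows "\<exists>\<chi>::'v \<Rightarrow> bool. \<forall>u v. {u, v} \<in> E \<longrightarrow> (\<chi> u \<noteq> \<chi> v \<longleftrightarrow> {u, v} = e)"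
proof -
  obtain i g where i: "i < N" and g: "g \<in> carrier G" and e: "e = edge i g"
    using assms by (auto simp: E_def)
  obtain S T where "\<forall>j\<le>i. right_invariant G S (A j)" "\<forall>j\<in>{i<..N}. right_invariant G T (A j)"
    and cut: "\<forall>g\<in>carrier G. (g \<in> S) \<noteq> (g \<in> T) \<longleftrightarrow> g \<in> C i"
    using separated[OF i] by blast
  then have S: "\<And>j g h. j \<le> i \<Longrightarrow> g \<in> carrier G \<Longrightarrow> h \<in> A j \<Longrightarrow> g \<otimes> h \<in> S \<longleftrightarrow> g \<in> S"
    and T: "\<And>j g h. i < j \<Longrightarrow> j \<le> N \<Longrightarrow> g \<in> carrier G \<Longrightarrow> h \<in> A j \<Longrightarrow> g \<otimes> h \<in> T \<longleftrightarrow> g \<in> T"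
    by (auto simp: right_invariant_def)
  define \<chi> where "\<chi> v \<longleftrightarrow> (\<exists>j h. j \<le> N \<and> h \<in> carrier G \<and> v = vtx j h \<and>
      (if j \<le> i then inv g \<otimes> h \<in> S else inv g \<otimes> h \<in> T))" for v
  have \<chi>: "\<chi> (vtx j h) \<longleftrightarrow> (if j \<le> i then inv g \<otimes> h \<in> S else inv g \<otimes> h \<in> T)"
    if j: "j \<le> N" and h: "h \<in> carrier G" for j h
  proof -
    have "(if j \<le> i then inv g \<otimes> h \<in> S else inv g \<otimes> h \<in> T) \<longleftrightarrow>
          (if j \<le> i then inv g \<otimes> k \<in> S else inv g \<otimes> k \<in> T)"
      if k: "k \<in> carrier G" and hk: "inv h \<otimes> k \<in> A j" for k
    proof -
      have "inv g \<otimes> k = inv g \<otimes> h \<otimes> (inv h \<otimes> k)"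
        using g h k by (simp add: m_assoc)
      then show ?thesis
        using S[of j "inv g \<otimes> h" "inv h \<otimes> k"] T[of j "inv g \<otimes> h" "inv h \<otimes> k"] hk j g h
        by auto
    qed
    then show ?thesis using j h vtx_eq_iff unfolding \<chi>_def by (smt (verit) l_inv subgroup.one_closed subgroup_A)
  qed
  have key: "\<chi> (vtx j h) \<noteq> \<chi> (vtx (Suc j) h) \<longleftrightarrow> edge j h = e" if "j < N" "h \<in> carrier G" for j h
  proof -
    have "\<chi> (vtx j h) \<noteq> \<chi> (vtx (Suc j) h) \<longleftrightarrow> j = i \<and> inv g \<otimes> h \<in> C i"
      using \<chi>[of j h] \<chi>[of "Suc j" h] cut[rule_format, of "inv g \<otimes> h"] that g by auto
    also have "\<dots> \<longleftrightarrow> edge j h = e"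
      using edge_eq_iff[of i j g h] that g i unfolding e by auto
    finally show ?thesis .
  qed
  show ?thesis
  proof (intro exI[of _ \<chi>] allI impI)
    fix u v assume "{u, v} \<in> E"
    then obtain j h where "j < N" "h \<in> carrier G"
      "u = vtx j h \<and> v = vtx (Suc j) h \<or> u = vtx (Suc j) h \<and> v = vtx j h"
      by (rule edgeE)
    then show "\<chi> u \<noteq> \<chi> v \<longleftrightarrow> {u, v} = e" using key[of j h] by (auto simp: edge_def insert_commute)
  qed
qed

abbreviation connected (infix \<open>\<leadsto>\<close> 50) where
  "u \<leadsto> v \<equiv> (\<lambda>u v. {u, v} \<in> E)\<^sup>*\<^sup>* u v"

lemma connected_sym: "u \<leadsto> v \<Longrightarrow> v \<leadsto> u"
  using symp_rtranclp[of "\<lambda>u v. {u, v} \<in> E"] by (auto simp: symp_def insert_commute)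

lemma vtx_connected_vtx:
  assumes g: "g \<in> carrier G" and i: "i \<le> N"
  shows "vtx 0 g \<leadsto> vtx i g"
  using i
proof (induction i)
  case (Suc i)
  then have "{vtx i g, vtx (Suc i) g} \<in> E" using edge_in_E[of i g] g by (simp add: edge_def)
  then show ?case using Suc by (auto intro: rtranclp.rtrancl_into_rtrancl)
qed simp

lemma base_connected:
  assumes "g \<in> generate G (\<Union>i\<le>N. A i)"
  shows "\<forall>k\<in>carrier G. vtx 0 k \<leadsto> vtx 0 (k \<otimes> g)"
proof -
  have step: "vtx 0 k \<leadsto> vtx 0 (k \<otimes> h)" if "h \<in> A i" "i \<le> N" "k \<in> carrier G" for h i k
  proof -
    have h: "h \<in> carrier G" using that A_in_carrier by auto
    then have "vtx i k = vtx i (k \<otimes> h)" using that by (simp add: vtx_eq_iff)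
    then show ?thesis
      using vtx_connected_vtx[of k i] connected_sym[OF vtx_connected_vtx[of "k \<otimes> h" i]] that h
      by (auto intro: rtranclp_trans)
  qed
  have sub: "(\<Union>i\<le>N. A i) \<subseteq> carrier G" using A_in_carrier by auto
  show ?thesis using assms
  proof induction
    case one
    then show ?case by simp
  next
    case (incl h)
    then show ?case using step by auto
  next
    case (inv h)
    then obtain i where "i \<le> N" "inv h \<in> A i" using A_inv by auto
    then show ?case using step by blast
  next
    case (eng g h)
    then have gh: "g \<in> carrier G" "h \<in> carrier G" using generate_incl[OF sub] by auto
    then have "vtx 0 k \<leadsto> vtx 0 (k \<otimes> (g \<otimes> h))" if "k \<in> carrier G" for k
      using eng.IH(1)[rule_format, of k] eng.IH(2)[rule_format, of "k \<otimes> g"] that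
      by (auto simp: m_assoc intro: rtranclp_trans)
    then show ?case by blast
  qed
qed

theorem is_tree: "is_tree V E"
  unfolding is_tree_def
proof (intro conjI ballI)
  show "V \<noteq> {}" using vtx_in_V[of 0 \<one>] by auto
  show "\<not> (\<exists>p. reduced_edge_path V E p \<and> length p > 1 \<and> hd p = last p)"
    by (rule no_reduced_closed_path_if_bridges) (rule edge_is_bridge)
  fix u v assume u: "u \<in> V" and v: "v \<in> V"
  have from_base: "vtx 0 \<one> \<leadsto> v" if "v \<in> V" for v
  proof -
    obtain i g where "v = vtx i g" "i \<le> N" "g \<in> carrier G" using \<open>v \<in> V\<close> by (auto simp: V_def)
    then have "vtx 0 \<one> \<leadsto> vtx 0 (\<one> \<otimes> g)" "vtx 0 g \<leadsto> v"
      using base_connected[of g, rule_format, of \<one>] generates vtx_connected_vtx[of g i] by auto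
    then show ?thesis using \<open>g \<in> carrier G\<close> by (auto intro: rtranclp_trans)
  qed
  have "u \<leadsto> v" using from_base[OF v] connected_sym[OF from_base[OF u]] by (rule rtranclp_trans[rotated])
  then show "\<exists>p. edge_path V E p \<and> hd p = u \<and> last p = v"
    using edge_path_if_rtranclp[OF is_graph] u by blast
qed (rule is_graph)

lemma act_mult:
  assumes "g \<in> carrier G" "h \<in> carrier G" "v \<in> V"
  shows "act (g \<otimes> h) v = act g (act h v)"
  using assms by (auto simp: V_def act_vtx m_assoc)

lemma act_closed: "g \<in> carrier G \<Longrightarrow> v \<in> V \<Longrightarrow> act g v \<in> V"
  using vtx_in_V by (force simp: V_def act_vtx)

lemma act_one: "v \<in> V \<Longrightarrow> act \<one> v = v"
  by (auto simp: V_def act_vtx)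

lemma act_in_Bij:
  assumes "g \<in> carrier G"
  shows "act g \<in> Bij V"
proof -
  have "bij_betw (act g) V V"
    by (rule bij_betwI[of _ _ _ "act (inv g)"])
       (use assms in \<open>auto simp: act_closed act_one simp flip: act_mult\<close>)
  then show ?thesis by (simp add: Bij_def act_def)
qed

theorem tree_action: "tree_action G V E act"
  unfolding tree_action_def
proof (intro conjI ballI allI impI)
  show "is_tree V E" by (rule is_tree)
  have "act \<in> hom G (BijGroup V)"
  proof (rule homI)
    fix g h assume gh: "g \<in> carrier G" "h \<in> carrier G"
    show "act (g \<otimes> h) = act g \<otimes>\<^bsub>BijGroup V\<^esub> act h"
    proof
      fix v
      show "act (g \<otimes> h) v = (act g \<otimes>\<^bsub>BijGroup V\<^esub> act h) v"
        using gh act_mult[of g h v] act_in_Bij[of g] act_in_Bij[of h]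
        by (cases "v \<in> V") (auto simp: BijGroup_def compose_def act_def)
    qed
  qed (simp add: BijGroup_def act_in_Bij)
  then show "group_action G V act"
    by (intro group_action.intro group_hom.intro group_hom_axioms.intro group_BijGroup is_group)
  show "edge_act act g e \<in> E" if "g \<in> carrier G" "e \<in> E" for g e
    using that edge_in_E by (force simp: E_def edge_act_edge)
  show "\<not> (act g u = v \<and> act g v = u)" if g: "g \<in> carrier G" and "{u, v} \<in> E" for g u v
  proof -
    obtain i h where "i < N" "h \<in> carrier G"
      "u = vtx i h \<and> v = vtx (Suc i) h \<or> u = vtx (Suc i) h \<and> v = vtx i h"
      using \<open>{u, v} \<in> E\<close> by (rule edgeE)
    then show ?thesis using g by (auto simp: act_vtx vtx_eq_iff)
  qed
qed

theorem card_edge_orbits: "card (edge_orbits G E act) = N"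
proof -
  have orbit: "orbit G (edge_act act) (edge i g) = {edge i h | h. h \<in> carrier G}"
    if "i < N" "g \<in> carrier G" for i g
  proof -
    have "\<exists>k\<in>carrier G. h = k \<otimes> g" if "h \<in> carrier G" for h
      using that \<open>g \<in> carrier G\<close> by (intro bexI[of _ "h \<otimes> inv g"]) (auto simp: m_assoc)
    then show ?thesis using that unfolding orbit_def by (auto simp: edge_act_edge) (metis edge_act_edge)
  qed
  have "edge_orbits G E act = (\<lambda>i. {edge i h | h. h \<in> carrier G}) ` {..<N}"
  proof (intro equalityI subsetI)
    fix x assume "x \<in> (\<lambda>i. {edge i h | h. h \<in> carrier G}) ` {..<N}"
    then obtain i where "i < N" "x = {edge i h | h. h \<in> carrier G}" by blast
    then show "x \<in> edge_orbits G E act"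
      using orbit[of i \<one>] edge_in_E[of i \<one>] unfolding orbits_def by blast
  qed (use orbit in \<open>auto simp: orbits_def E_def\<close>)
  moreover have "inj_on (\<lambda>i. {edge i h | h. h \<in> carrier G}) {..<N}"
  proof (rule inj_onI)
    fix i j assume ij: "i \<in> {..<N}" "j \<in> {..<N}"
      and "{edge i h | h. h \<in> carrier G} = {edge j h | h. h \<in> carrier G}"
    then have "edge i \<one> \<in> {edge j h | h. h \<in> carrier G}" by blast
    then show "i = j" using ij edge_eq_iff by auto
  qed
  ultimately show ?thesis by (simp add: card_image)
qed

lemma stabilizer_vtx:
  assumes "i \<le> N" "g \<in> carrier G"
  shows "stabilizer G act (vtx i g) = {x \<in> carrier G. inv g \<otimes> x \<otimes> g \<in> A i}"
proof -
  have "act x (vtx i g) = vtx i g \<longleftrightarrow> inv g \<otimes> x \<otimes> g \<in> A i" if "x \<in> carrier G" for x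
    using assms that vtx_eq_iff[of i i g "x \<otimes> g"] by (auto simp: act_vtx m_assoc)
  then show ?thesis by (auto simp: stabilizer_def)
qed

lemma stabilizer_edge:
  assumes "i < N" "g \<in> carrier G"
  shows "stabilizer G (edge_act act) (edge i g) = {x \<in> carrier G. inv g \<otimes> x \<otimes> g \<in> C i}"
proof -
  have "edge_act act x (edge i g) = edge i g \<longleftrightarrow> inv g \<otimes> x \<otimes> g \<in> C i" if "x \<in> carrier G" for x
    using assms that edge_eq_iff[of i i g "x \<otimes> g"] by (auto simp: edge_act_edge m_assoc)
  then show ?thesis by (auto simp: stabilizer_def)
qed

text \<open>A connected invariant set of edges that avoids the index \<open>i\<close> stays on one side of it, hence in a
  single coset of the subgroup generated by the vertex groups of that side. Invariance under \<open>G\<close> makes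
  this subgroup everything.\<close>
theorem minimal_action:
  assumes "N > 0"
    and below: "\<And>i. i < N \<Longrightarrow> \<exists>L. subgroup L G \<and> (\<Union>j\<le>i. A j) \<subseteq> L \<and> L \<noteq> carrier G"
    and above: "\<And>i. i < N \<Longrightarrow> \<exists>L. subgroup L G \<and> (\<Union>j\<in>{i<..N}. A j) \<subseteq> L \<and> L \<noteq> carrier G"
  shows "minimal_action G V E act"
  unfolding minimal_action_def
proof (intro allI impI)
  fix V' E'
  assume "is_subtree V' E' V E \<and> (\<forall>g\<in>carrier G. act g ` V' \<subseteq> V' \<and> edge_act act g ` E' \<subseteq> E')"
  then have sub: "V' \<subseteq> V" "E' \<subseteq> E" and tree: "is_tree V' E'"
    and inv_V: "\<And>g v. g \<in> carrier G \<Longrightarrow> v \<in> V' \<Longrightarrow> act g v \<in> V'"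
    and inv_E: "\<And>g e. g \<in> carrier G \<Longrightarrow> e \<in> E' \<Longrightarrow> edge_act act g e \<in> E'"
    unfolding is_subtree_def by blast+
  have conn: "(\<lambda>u v. {u, v} \<in> E')\<^sup>*\<^sup>* u v" if "u \<in> V'" "v \<in> V'" for u v
    using tree that rtranclp_if_edge_path unfolding is_tree_def by metis
  have meets: "\<exists>g\<in>carrier G. edge i g \<in> E'" if i: "i < N" for i
  proof (rule ccontr)
    assume no: "\<not> (\<exists>g\<in>carrier G. edge i g \<in> E')"
    obtain j g where j: "j \<le> N" and g: "g \<in> carrier G" and v: "vtx j g \<in> V'"
    proof -
      obtain v where "v \<in> V'" using tree by (auto simp: is_tree_def)
      then show ?thesis using that sub(1) by (auto simp: V_def)
    qed
    \<comment> \<open>The side of the missing edges on which the subtree lies.\<close>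
    define J where "J = (if j \<le> i then {..i} else {i<..N})"
    have J: "j \<in> J" "J \<subseteq> {..N}" "\<And>k. k < N \<Longrightarrow> k \<noteq> i \<Longrightarrow> k \<in> J \<longleftrightarrow> Suc k \<in> J"
      using i j by (auto simp: J_def)
    obtain L where L: "subgroup L G" "(\<Union>j\<in>J. A j) \<subseteq> L" "L \<noteq> carrier G"
      using below[OF i] above[OF i] unfolding J_def by (cases "j \<le> i") auto
    have step: "\<exists>l k. l \<in> J \<and> k \<in> carrier G \<and> v = vtx l k \<and> inv g \<otimes> k \<in> L"
      if E': "{u, v} \<in> E'" and u: "\<exists>l k. l \<in> J \<and> k \<in> carrier G \<and> u = vtx l k \<and> inv g \<otimes> k \<in> L" for u v
    proof -
      obtain l k where k: "l \<in> J" "k \<in> carrier G" "u = vtx l k" "inv g \<otimes> k \<in> L" using u by blast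
      have "{u, v} \<in> E" using E' sub by auto
      then obtain m h where m: "m < N" "h \<in> carrier G"
        and uv: "u = vtx m h \<and> v = vtx (Suc m) h \<or> u = vtx (Suc m) h \<and> v = vtx m h"
        by (rule edgeE)
      then have "edge m h \<in> E'" using E' by (auto simp: edge_def insert_commute)
      then have "m \<noteq> i" using no m(2) by auto
      have mJ: "m \<in> J \<and> Suc m \<in> J" and "inv k \<otimes> h \<in> A l"
        using uv k m J(2) J(3)[OF m(1) \<open>m \<noteq> i\<close>] by (auto simp: vtx_eq_iff subset_iff)
      then have "inv k \<otimes> h \<in> L" using L(2) k(1) by auto
      then have "inv g \<otimes> k \<otimes> (inv k \<otimes> h) \<in> L" using k(4) L(1) by (auto intro: subgroup.m_closed)
      moreover have "inv g \<otimes> k \<otimes> (inv k \<otimes> h) = inv g \<otimes> h"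
        using g k(2) m(2) by (simp add: m_assoc)
      ultimately show ?thesis using uv m mJ by auto
    qed
    have reach: "\<exists>l k. l \<in> J \<and> k \<in> carrier G \<and> v = vtx l k \<and> inv g \<otimes> k \<in> L"
      if "(\<lambda>u v. {u, v} \<in> E')\<^sup>*\<^sup>* (vtx j g) v" for v
      using that
    proof induction
      case base
      then show ?case using J(1) g L(1) by (auto intro!: exI[of _ j] exI[of _ g] simp: subgroup.one_closed)
    qed (use step in blast)
    have "x \<in> L" if x: "x \<in> carrier G" for x
    proof -
      define y where "y = g \<otimes> x \<otimes> inv g"
      have y: "y \<in> carrier G" using g x by (simp add: y_def)
      have "act y (vtx j g) \<in> V'" using inv_V[OF y v] .
      then have "vtx j (g \<otimes> x) \<in> V'"
        using y g x j by (simp add: act_vtx y_def m_assoc)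
      then obtain l k where k: "l \<in> J" "k \<in> carrier G" "vtx j (g \<otimes> x) = vtx l k" "inv g \<otimes> k \<in> L"
        using reach[OF conn[OF v]] by blast
      then have "inv (g \<otimes> x) \<otimes> k \<in> L" using g x j J L(2) by (auto simp: vtx_eq_iff subset_iff)
      then have "inv g \<otimes> k \<otimes> inv (inv (g \<otimes> x) \<otimes> k) \<in> L"
        using k(4) L(1) by (auto intro: subgroup.m_closed subgroup.m_inv_closed)
      moreover have "inv g \<otimes> k \<otimes> inv (inv (g \<otimes> x) \<otimes> k) = x"
        using g x k(2) by (simp add: inv_mult_group m_assoc)
      ultimately show ?thesis by simp
    qed
    then show False using L(1,3) subgroup.subset by blast
  qed
  have edges: "edge i g \<in> E'" if "i < N" "g \<in> carrier G" for i g
  proof -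
    obtain h where h: "h \<in> carrier G" "edge i h \<in> E'" using meets[OF \<open>i < N\<close>] by blast
    have "edge_act act (g \<otimes> inv h) (edge i h) \<in> E'" using inv_E h that by simp
    then show ?thesis using h that by (simp add: edge_act_edge m_assoc)
  qed
  have "vtx i g \<in> V'" if "i \<le> N" "g \<in> carrier G" for i g
  proof -
    have "\<exists>j<N. vtx i g \<in> edge j g"
      using that \<open>N > 0\<close> by (intro exI[of _ "if i < N then i else N - 1"]) (auto simp: edge_def)
    then obtain j where "j < N" "vtx i g \<in> edge j g" by blast
    moreover from \<open>j < N\<close> have "edge j g \<in> E'" using edges \<open>g \<in> carrier G\<close> by blast
    moreover have "is_graph V' E'" using tree by (simp add: is_tree_def)
    ultimately obtain u v where "edge j g = {u, v}" "u \<in> V'" "v \<in> V'"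
      unfolding is_graph_def by blast
    then show ?thesis using \<open>vtx i g \<in> edge j g\<close> by auto
  qed
  then show "V' = V \<and> E' = E" using sub edges by (auto simp: V_def E_def)
qed

text \<open>If no conjugate of a vertex group is a conjugate of an edge group, the condition on valences is
  vacuous.\<close>
theorem reduced_tree:
  assumes "minimal_action G V E act"
    and ne: "\<And>i j g h. \<lbrakk>i \<le> N; j < N; g \<in> carrier G; h \<in> carrier G\<rbrakk> \<Longrightarrow>
      {x \<in> carrier G. inv g \<otimes> x \<otimes> g \<in> A i} \<noteq> {x \<in> carrier G. inv h \<otimes> x \<otimes> h \<in> C j}"
  shows "reduced_tree G V E act"
proof -
  have "stabilizer G act v \<noteq> stabilizer G (edge_act act) e" if "v \<in> V" "e \<in> E" for v e
    using that ne by (auto simp: V_def E_def stabilizer_vtx stabilizer_edge)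
  then show ?thesis using assms(1) unfolding reduced_tree_def by blast
qed

text \<open>A group fixing two adjacent edges lies, up to conjugation, in \<open>C j \<inter> u C k u\<inverse>\<close> where \<open>u\<close> is in the
  group of the common vertex. So acylindricity only concerns how the edge groups sit inside a single
  vertex group.\<close>
theorem acylindrical_noncyclic:
  assumes cyclic: "\<And>i j k u H. \<lbrakk>i \<le> N; j < N; k < N; i \<in> {j, Suc j}; i \<in> {k, Suc k}; u \<in> A i;
      j \<noteq> k \<or> u \<notin> C j; subgroup H G; H \<subseteq> C j; \<And>h. h \<in> H \<Longrightarrow> inv u \<otimes> h \<otimes> u \<in> C k\<rbrakk> \<Longrightarrow>
      cyclic_group (G\<lparr>carrier := H\<rparr>)"
  shows "acylindrical_on V E act 1 (noncyclic_subgroups G)"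
  unfolding acylindrical_on_def
proof (intro ballI allI impI, elim conjE, rule ccontr)
  fix H p
  assume H: "H \<in> noncyclic_subgroups G" and p: "reduced_edge_path V E p"
    and fixes_p: "\<forall>i. Suc i < length p \<longrightarrow> (\<forall>h\<in>H. edge_act act h {p ! i, p ! Suc i} = {p ! i, p ! Suc i})"
    and "\<not> length p - 1 \<le> 1"
  then have len: "length p > 2" by simp
  have edge_p: "{p ! k, p ! Suc k} \<in> E" if "Suc k < length p" for k
    using p that successively_nth[of "\<lambda>u v. {u, v} \<in> E" p k]
    by (simp add: reduced_edge_path_def edge_path_def)
  have H_sub: "H \<subseteq> carrier G" using H subgroup.subset by (auto simp: noncyclic_subgroups_def)
  have e1: "{p ! 0, p ! 1} \<in> E" and e2: "{p ! 1, p ! 2} \<in> E"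
    using edge_p[of 0] edge_p[of 1] len by (auto simp: numeral_2_eq_2)
  obtain j g where j: "j < N" "g \<in> carrier G" and jg: "{p ! 0, p ! 1} = edge j g"
    using e1 by (auto simp: E_def)
  obtain k g' where k: "k < N" "g' \<in> carrier G" and kg: "{p ! 1, p ! 2} = edge k g'"
    using e2 by (auto simp: E_def)
  obtain i where i: "i \<in> {j, Suc j}" "p ! 1 = vtx i g" using jg by (auto simp: edge_def doubleton_eq_iff)
  obtain i' where i': "i' \<in> {k, Suc k}" "p ! 1 = vtx i' g'" using kg by (auto simp: edge_def doubleton_eq_iff)
  define u where "u = inv g \<otimes> g'"
  have iN: "i \<le> N" using i j by auto
  have eq: "i' = i" and u: "u \<in> A i"
    using i i' j k vtx_eq_iff[of i i' g g'] by (auto simp: u_def)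
  have uc: "u \<in> carrier G" using j k by (simp add: u_def)
  have g': "g' = g \<otimes> u" using j k by (simp add: u_def m_assoc[symmetric])
  have "p ! 0 \<noteq> p ! 2" using p len by (auto simp: reduced_edge_path_def numeral_2_eq_2)
  then have "edge j g \<noteq> edge k g'" unfolding jg[symmetric] kg[symmetric] by (auto simp: doubleton_eq_iff)
  then have distinct: "j \<noteq> k \<or> u \<notin> C j" using edge_eq_iff j k by (auto simp: u_def)
  \<comment> \<open>Conjugation moves the first edge to the base edge of its index.\<close>
  define K where "K = inv g <# H #> inv (inv g)"
  have K: "K \<in> noncyclic_subgroups G"
    unfolding K_def using H j by (intro noncyclic_subgroups_conjugation_closed) auto
  have K_eq: "K = (\<lambda>h. inv g \<otimes> h \<otimes> g) ` H"
    using j by (auto simp: K_def l_coset_def r_coset_def)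
  have "h \<in> stabilizer G (edge_act act) (edge j g)" "h \<in> stabilizer G (edge_act act) (edge k g')" if "h \<in> H" for h
    using fixes_p[rule_format, of 0 h] fixes_p[rule_format, of 1 h] that len jg kg H_sub
    by (auto simp: stabilizer_def numeral_2_eq_2)
  then have "inv g \<otimes> h \<otimes> g \<in> C j" "inv g' \<otimes> h \<otimes> g' \<in> C k" if "h \<in> H" for h
    using that j k by (auto simp: stabilizer_edge)
  moreover have "inv g' \<otimes> h \<otimes> g' = inv u \<otimes> (inv g \<otimes> h \<otimes> g) \<otimes> u" if "h \<in> H" for h
    using that H_sub j uc unfolding g' by (auto simp: inv_mult_group m_assoc)
  ultimately have "K \<subseteq> C j" "\<And>h. h \<in> K \<Longrightarrow> inv u \<otimes> h \<otimes> u \<in> C k" by (auto simp: K_eq)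
  then have "cyclic_group (G\<lparr>carrier := K\<rparr>)"
    using cyclic[of i j k u K] iN i(1) i'(1) eq u distinct j k K by (auto simp: noncyclic_subgroups_def)
  then show False using K by (simp add: noncyclic_subgroups_def)
qed

end

section \<open>Free groups: homomorphisms and exponent sums\<close>

abbreviation flip_letter :: "'a \<times> bool \<Rightarrow> 'a \<times> bool" where
  "flip_letter \<equiv> \<lambda>(s, e). (s, \<not> e)"

lemma flip_flip: "flip_letter (flip_letter x) = x"
  by (cases x) simp

lemma inverse_letters_iff: "inverse_letters x y \<longleftrightarrow> y = flip_letter x"
  by (cases x; cases y) (auto simp: inverse_letters_def)

lemma reduced_word_Nil [simp]: "reduced_word []"
  by (simp add: reduced_word_def)

lemma reduced_word_Cons:
  "reduced_word (x # w) \<longleftrightarrow> reduced_word w \<and> (w \<noteq> [] \<longrightarrow> hd w \<noteq> flip_letter x)"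
  by (cases w) (auto simp: reduced_word_def inverse_letters_iff)

lemma reduced_word_append:
  "reduced_word (v @ w) \<longleftrightarrow> reduced_word v \<and> reduced_word w \<and>
     (v \<noteq> [] \<longrightarrow> w \<noteq> [] \<longrightarrow> hd w \<noteq> flip_letter (last v))"
  by (auto simp: reduced_word_def successively_append_iff inverse_letters_iff)

lemma carrier_free_group: "w \<in> carrier (free_group S) \<longleftrightarrow> reduced_word w \<and> fst ` set w \<subseteq> S"
  by (simp add: free_group_def)

lemma mult_free_group: "v \<otimes>\<^bsub>free_group S\<^esub> w = foldr cons_reduce v w"
  by (simp add: free_group_def)

lemma one_free_group: "\<one>\<^bsub>free_group S\<^esub> = []"
  by (simp add: free_group_def)

interpretation free: group "free_group S" for S :: "'a set"
  by (rule group_free_group)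

lemma mult_eq_append:
  assumes "reduced_word (v @ w)"
  shows "v \<otimes>\<^bsub>free_group S\<^esub> w = v @ w"
proof -
  have "foldr cons_reduce v w = v @ w" using assms
  proof (induction v)
    case (Cons x v)
    then have "foldr cons_reduce v w = v @ w" by (simp add: reduced_word_Cons)
    then show ?case using Cons.prems
      by (cases "v @ w") (auto simp: reduced_word_Cons inverse_letters_iff)
  qed simp
  then show ?thesis by (simp add: mult_free_group)
qed

lemma Cons_eq_mult: "reduced_word (x # w) \<Longrightarrow> x # w = [x] \<otimes>\<^bsub>free_group S\<^esub> w"
  using mult_eq_append[of "[x]" w S] by simp

lemma Cons_in_free_group:
  "x # w \<in> carrier (free_group S) \<Longrightarrow> fst x \<in> S \<and> w \<in> carrier (free_group S) \<and> [x] \<in> carrier (free_group S)"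
  by (auto simp: carrier_free_group reduced_word_Cons)

lemma letter_in_free_group [simp]: "[(s, e)] \<in> carrier (free_group S) \<longleftrightarrow> s \<in> S"
  by (auto simp: carrier_free_group reduced_word_Cons)

lemma reduced_word_inverse: "reduced_word w \<Longrightarrow> reduced_word (rev (map flip_letter w))"
  by (auto simp: reduced_word_def successively_map inverse_letters_def case_prod_beta
      elim!: successively_mono)

lemma inv_free_group:
  assumes "w \<in> carrier (free_group S)"
  shows "inv\<^bsub>free_group S\<^esub> w = rev (map flip_letter w)"
proof (rule free.inv_equality)
  show "rev (map flip_letter w) \<otimes>\<^bsub>free_group S\<^esub> w = \<one>\<^bsub>free_group S\<^esub>"
    using foldr_cons_reduce_inverse[of w] assms
    by (simp add: mult_free_group one_free_group carrier_free_group foldr_cons_reduce_Nil)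
  show "rev (map flip_letter w) \<in> carrier (free_group S)"
    using assms by (force simp: carrier_free_group reduced_word_inverse)
qed (rule assms)

lemma free_group_subset_subgroup:
  assumes K: "subgroup K (free_group S)" and gens: "\<And>s. s \<in> S \<Longrightarrow> [(s, True)] \<in> K"
  shows "carrier (free_group S) \<subseteq> K"
proof
  fix w :: "'a word" assume "w \<in> carrier (free_group S)"
  then show "w \<in> K"
  proof (induction w)
    case Nil
    then show ?case using subgroup.one_closed[OF K] by (simp add: one_free_group)
  next
    case (Cons x w)
    obtain s e where x: "x = (s, e)" by (cases x)
    have s: "s \<in> S" and w: "w \<in> K" using Cons Cons_in_free_group[of x w S] x by auto
    have "[(s, False)] = inv\<^bsub>free_group S\<^esub> [(s, True)]" using s by (simp add: inv_free_group)
    then have "[x] \<in> K" using gens[OF s] subgroup.m_inv_closed[OF K] x by (cases e) auto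
    moreover have "x # w = [x] \<otimes>\<^bsub>free_group S\<^esub> w"
      using Cons.prems by (intro Cons_eq_mult) (auto simp: carrier_free_group)
    ultimately show ?case using w subgroup.m_closed[OF K] by simp
  qed
qed

text \<open>The homomorphism given by the universal property of the free group.\<close>
definition lift :: "('b, 'm) monoid_scheme \<Rightarrow> ('a \<Rightarrow> 'b) \<Rightarrow> 'a word \<Rightarrow> 'b" where
  "lift H f w = foldr (\<lambda>x g. (if snd x then f (fst x) else inv\<^bsub>H\<^esub> f (fst x)) \<otimes>\<^bsub>H\<^esub> g) w \<one>\<^bsub>H\<^esub>"

lemma lift_Nil [simp]: "lift H f [] = \<one>\<^bsub>H\<^esub>"
  by (simp add: lift_def)

lemma lift_Cons:
  "lift H f (x # w) = (if snd x then f (fst x) else inv\<^bsub>H\<^esub> f (fst x)) \<otimes>\<^bsub>H\<^esub> lift H f w"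
  by (simp add: lift_def)

lemma lift_in_subgroup:
  assumes K: "subgroup K H" and f: "\<And>s. s \<in> fst ` set w \<Longrightarrow> f s \<in> K"
  shows "lift H f w \<in> K"
  using f by (induction w)
    (auto simp: lift_Cons intro!: subgroup.one_closed[OF K] subgroup.m_closed[OF K] subgroup.m_inv_closed[OF K])

lemma (in group) lift_closed:
  "(\<And>s. s \<in> fst ` set w \<Longrightarrow> f s \<in> carrier G) \<Longrightarrow> lift G f w \<in> carrier G"
  by (rule lift_in_subgroup[OF subgroup_self])

lemma (in group) lift_mult:
  assumes "f \<in> S \<rightarrow> carrier G" "fst ` set v \<subseteq> S" "fst ` set w \<subseteq> S"
  shows "lift G f (foldr cons_reduce v w) = lift G f v \<otimes> lift G f w"
proof -
  have cons: "lift G f (cons_reduce x u) = lift G f [x] \<otimes> lift G f u"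
    if "fst x \<in> S" "fst ` set u \<subseteq> S" for x u
  proof (cases u)
    case (Cons y u')
    have "lift G f u' \<in> carrier G" "f (fst x) \<in> carrier G" "f (fst y) \<in> carrier G"
      using that assms(1) Cons by (auto intro!: lift_closed)
    then show ?thesis using Cons by (auto simp: lift_Cons inverse_letters_def)
  qed (use that Pi_mem[OF assms(1), of "fst x"] in \<open>auto simp: lift_Cons\<close>)
  show ?thesis using assms(2)
  proof (induction v)
    case Nil
    have "lift G f w \<in> carrier G" using assms by (auto intro!: lift_closed)
    then show ?case by simp
  next
    case (Cons x v)
    have "fst ` set (foldr cons_reduce v w) \<subseteq> S"
      using set_foldr_cons_reduce[of v w] Cons.prems assms(3) by (auto simp: image_subset_iff)
    moreover have "lift G f v \<in> carrier G" "lift G f w \<in> carrier G" "f (fst x) \<in> carrier G"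
      using Cons.prems assms by (auto intro!: lift_closed)
    ultimately show ?case using Cons cons[of x "foldr cons_reduce v w"] by (auto simp: lift_Cons m_assoc)
  qed
qed

lemma (in group) lift_hom: "f \<in> S \<rightarrow> carrier G \<Longrightarrow> lift G f \<in> hom (free_group S) G"
  by (rule homI) (auto simp: carrier_free_group mult_free_group lift_mult intro!: lift_closed)

lemma hom_lift:
  assumes "group_hom G H \<phi>" "\<And>s. s \<in> fst ` set w \<Longrightarrow> f s \<in> carrier G"
  shows "\<phi> (lift G f w) = lift H (\<phi> \<circ> f) w"
proof -
  interpret group_hom G H \<phi> by fact
  show ?thesis using assms(2)
    by (induction w) (auto simp: lift_Cons G.lift_closed)
qed

lemma lift_cong: "(\<And>s. s \<in> fst ` set w \<Longrightarrow> f s = g s) \<Longrightarrow> lift H f w = lift H g w"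
  by (induction w) (auto simp: lift_Cons)

text \<open>If the image of every generator \<open>s\<close> begins and ends with \<open>s\<close>, substitution into a reduced word meets
  no cancellation: at each seam the last letter of one image and the first letter of the next are
  the two letters of the original word. In particular the substitution is injective.\<close>
lemma lift_framed:
  assumes f: "\<And>s. s \<in> S \<Longrightarrow> f s \<in> carrier (free_group S)"
    and frame: "\<And>s. s \<in> S \<Longrightarrow> f s \<noteq> [] \<and> hd (f s) = (s, True) \<and> last (f s) = (s, True)"
    and w: "w \<in> carrier (free_group S)" "w \<noteq> []"
  shows "lift (free_group S) f w \<noteq> [] \<and> hd (lift (free_group S) f w) = hd w \<and>
    last (lift (free_group S) f w) = last w"
  using w
proof (induction w)
  case (Cons x w)
  define u where "u = (if snd x then f (fst x) else inv\<^bsub>free_group S\<^esub> f (fst x))"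
  have x: "fst x \<in> S" and w: "w \<in> carrier (free_group S)" using Cons.prems Cons_in_free_group by blast+
  have u_in: "u \<in> carrier (free_group S)" using f[OF x] by (simp add: u_def)
  have u: "u \<noteq> []" "hd u = x" "last u = x"
    using frame[OF x] f[OF x]
    by (auto simp: u_def inv_free_group hd_rev last_rev hd_map last_map prod_eq_iff case_prod_beta)
  have Lw: "lift (free_group S) f w \<in> carrier (free_group S)"
    using f w by (intro free.lift_closed) (auto simp: carrier_free_group)
  show ?case
  proof (cases "w = []")
    case True
    then show ?thesis using u u_in by (simp add: lift_Cons flip: u_def)
  next
    case False
    have "hd w \<noteq> flip_letter x" using Cons.prems False by (auto simp: carrier_free_group reduced_word_Cons)
    then have "reduced_word (u @ lift (free_group S) f w)"
      using Cons.IH[OF w False] u u_in Lw by (auto simp: reduced_word_append carrier_free_group)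
    then have "lift (free_group S) f (x # w) = u @ lift (free_group S) f w"
      by (simp add: lift_Cons mult_eq_append flip: u_def)
    then show ?thesis using u Cons.IH[OF w False] False by simp
  qed
qed simp

text \<open>The homomorphism to the integers with weights \<open>f\<close> on the generators.\<close>
definition exponent :: "('a \<Rightarrow> int) \<Rightarrow> 'a word \<Rightarrow> int" where
  "exponent f w = (\<Sum>x\<leftarrow>w. if snd x then f (fst x) else - f (fst x))"

lemma exponent_simps [simp]:
  "exponent f [] = 0"
  "exponent f (x # w) = (if snd x then f (fst x) else - f (fst x)) + exponent f w"
  by (simp_all add: exponent_def)

lemma exponent_mult: "exponent f (v \<otimes>\<^bsub>free_group S\<^esub> w) = exponent f v + exponent f w"
proof -
  have "exponent f (cons_reduce x u) = exponent f [x] + exponent f u" for x u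
    by (cases u) (auto simp: inverse_letters_def)
  then show ?thesis unfolding mult_free_group by (induction v) auto
qed

lemma exponent_inv:
  assumes "w \<in> carrier (free_group S)"
  shows "exponent f (inv\<^bsub>free_group S\<^esub> w) = - exponent f w"
  using exponent_mult[of f S "inv\<^bsub>free_group S\<^esub> w" w] assms by (simp add: one_free_group)

lemma exponent_conj:
  assumes "g \<in> carrier (free_group S)"
  shows "exponent f (inv\<^bsub>free_group S\<^esub> g \<otimes>\<^bsub>free_group S\<^esub> h \<otimes>\<^bsub>free_group S\<^esub> g) = exponent f h"
  using assms by (simp add: exponent_mult exponent_inv)

lemma exponent_lift:
  assumes "\<And>s. s \<in> fst ` set w \<Longrightarrow> u s \<in> carrier (free_group S)"
  shows "exponent f (lift (free_group S) u w) = exponent (\<lambda>s. exponent f (u s)) w"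
  using assms by (induction w) (auto simp: lift_Cons exponent_mult exponent_inv one_free_group)

lemma exponent_dvd: "(\<And>s. s \<in> fst ` set w \<Longrightarrow> d dvd f s) \<Longrightarrow> d dvd exponent f w"
  by (induction w) auto

text \<open>Without sign changes the sum is the length of the word up to sign.\<close>
lemma exponent_one_sided:
  assumes "successively (\<lambda>x y. snd x = snd y) w" "w \<noteq> []"
  shows "exponent (\<lambda>_. 1) w \<noteq> 0"
proof -
  have "exponent (\<lambda>_. 1) w = (if snd (hd w) then int (length w) else - int (length w))" using assms
  proof (induction w)
    case (Cons x w)
    then show ?case by (cases w) auto
  qed simp
  then show ?thesis using assms(2) by auto
qed

text \<open>The group embeds in the integers: an element of least positive value generates it.\<close>
lemma (in group) cyclic_group_if_int_valued:
  assumes add: "\<And>x y. x \<in> carrier G \<Longrightarrow> y \<in> carrier G \<Longrightarrow> \<theta> (x \<otimes> y) = \<theta> x + \<theta> y"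
    and inj: "\<And>x. x \<in> carrier G \<Longrightarrow> \<theta> x = (0::int) \<Longrightarrow> x = \<one>"
  shows "cyclic_group G"
proof -
  interpret \<theta>: group_hom G integer_group \<theta>
    by (intro group_hom.intro group_hom_axioms.intro is_group group_integer_group) (auto simp: hom_def add)
  have pow: "\<theta> (x [^] (n::int)) = n * \<theta> x" if "x \<in> carrier G" for x n
    using \<theta>.hom_int_pow[OF that] by simp
  show ?thesis
  proof (cases "\<exists>x\<in>carrier G. \<theta> x > 0")
    case False
    have "x = \<one>" if x: "x \<in> carrier G" for x
    proof -
      have "\<theta> (inv x) = - \<theta> x" using \<theta>.hom_inv[OF x] by simp
      then have "\<theta> x = 0" using False x by (metis inv_closed neg_0_less_iff_less not_less_iff_gr_or_eq)
      then show ?thesis using inj x by blast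
    qed
    then have "trivial_group G" using is_group by (auto simp: trivial_group_def)
    then show ?thesis by (rule trivial_imp_cyclic_group)
  next
    case True
    \<comment> \<open>A generator is an element of least positive value.\<close>
    define attained where "attained n \<longleftrightarrow> n > 0 \<and> (\<exists>x\<in>carrier G. \<theta> x = int n)" for n
    obtain x0 where "x0 \<in> carrier G" "\<theta> x0 > 0" using True by blast
    then have "attained (nat (\<theta> x0))" by (auto simp: attained_def)
    then obtain d where d: "attained d" and least: "\<And>n. n < d \<Longrightarrow> \<not> attained n"
      using exists_least_iff[of attained] by blast
    then have "d > 0" by (simp add: attained_def)
    from d obtain c where c: "c \<in> carrier G" "\<theta> c = int d" by (auto simp: attained_def)
    have "x \<in> range (\<lambda>n::int. c [^] n)" if x: "x \<in> carrier G" for x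
    proof -
      define q where "q = \<theta> x div int d"
      define y where "y = x \<otimes> c [^] (- q)"
      have y: "y \<in> carrier G" using x c by (simp add: y_def)
      have \<theta>y: "\<theta> y = \<theta> x mod int d"
        using x c pow[of c "- q"] by (simp add: y_def add q_def minus_div_mult_eq_mod)
      have "0 \<le> \<theta> y" "\<theta> y < int d" using \<open>d > 0\<close> by (simp_all add: \<theta>y)
      then have "\<theta> y = 0" using least[of "nat (\<theta> y)"] y by (force simp: attained_def nat_less_iff)
      then have "y = \<one>" using inj y by blast
      then have "x = c [^] q" using x c by (simp add: y_def int_pow_neg inv_solve_right')
      then show ?thesis by blast
    qed
    then have "carrier G = range (\<lambda>n::int. c [^] n)" using c by auto
    then show ?thesis using cyclic_group c(1) by blast
  qed
qed


section \<open>Labelled graphs and conjugates of subgroups\<close>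

text \<open>A graph with edges labelled by generators, read in both directions: traversing an edge backwards
  reads the inverse letter. A folded graph is one in which a word can be read in at most one way from
  a given vertex; its loops at a vertex form a subgroup (the Stallings graph of that subgroup).\<close>
type_synonym ('q, 'a) automaton = "('q \<times> 'a \<times> 'q) set"

definition step :: "('q, 'a) automaton \<Rightarrow> 'q \<Rightarrow> 'a \<times> bool \<Rightarrow> 'q \<Rightarrow> bool" where
  "step M p x q \<longleftrightarrow> (if snd x then (p, fst x, q) \<in> M else (q, fst x, p) \<in> M)"

fun reads :: "('q, 'a) automaton \<Rightarrow> 'q \<Rightarrow> 'a word \<Rightarrow> 'q \<Rightarrow> bool" where
  "reads M p [] q \<longleftrightarrow> p = q"
| "reads M p (x # w) q \<longleftrightarrow> (\<exists>r. step M p x r \<and> reads M r w q)"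

definition folded :: "('q, 'a) automaton \<Rightarrow> bool" where
  "folded M \<longleftrightarrow> (\<forall>p x q q'. step M p x q \<longrightarrow> step M p x q' \<longrightarrow> q = q')"

lemma step_flip: "step M p (flip_letter x) q \<longleftrightarrow> step M q x p"
  by (auto simp: step_def split: prod.splits)

lemma foldedD: "folded M \<Longrightarrow> step M p x q \<Longrightarrow> step M p x q' \<Longrightarrow> q = q'"
  unfolding folded_def by blast

lemma reads_one [simp]: "reads M p \<one>\<^bsub>free_group S\<^esub> q \<longleftrightarrow> p = q"
  by (simp add: one_free_group)

lemma reads_append: "reads M p (v @ w) q \<longleftrightarrow> (\<exists>r. reads M p v r \<and> reads M r w q)"
  by (induction v arbitrary: p) auto

lemma reads_inverse: "reads M p (rev (map flip_letter w)) q \<longleftrightarrow> reads M q w p"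
  by (induction w arbitrary: q) (auto simp: reads_append step_flip)

lemma reads_deterministic: "folded M \<Longrightarrow> reads M p w q \<Longrightarrow> reads M p w q' \<Longrightarrow> q = q'"
proof (induction w arbitrary: p)
  case (Cons x w)
  then show ?case using foldedD by (metis reads.simps(2))
qed simp

lemma reads_inv:
  "w \<in> carrier (free_group S) \<Longrightarrow> reads M p (inv\<^bsub>free_group S\<^esub> w) q \<longleftrightarrow> reads M q w p"
  by (simp add: inv_free_group reads_inverse)

text \<open>Cancelling a letter against its inverse removes a step and its reversal from the path, as the graph is
  folded.\<close>
lemma reads_mult:
  assumes M: "folded M" and v: "reads M p v q" and w: "reads M q w r"
  shows "reads M p (v \<otimes>\<^bsub>free_group S\<^esub> w) r"
proof -
  have cons: "reads M p (cons_reduce x u) r" if x: "step M p x q" and u: "reads M q u r" for p x u q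
  proof (cases u)
    case (Cons y u')
    show ?thesis
    proof (cases "inverse_letters x y")
      case True
      then have y: "y = flip_letter x" by (simp add: inverse_letters_iff)
      obtain q' where "step M q y q'" "reads M q' u' r" using u Cons by auto
      moreover have "step M q y p" using x by (simp add: y step_flip)
      ultimately show ?thesis using foldedD[OF M] Cons True by fastforce
    qed (use x u Cons in auto)
  qed (use x u in auto)
  show ?thesis using v unfolding mult_free_group
    by (induction v arbitrary: p) (use w in \<open>auto intro: cons\<close>)
qed

definition loops :: "('q, 'a) automaton \<Rightarrow> 'q \<Rightarrow> 'a set \<Rightarrow> 'a word set" where
  "loops M p S = {w \<in> carrier (free_group S). reads M p w p}"

lemma subgroup_loops:
  assumes "folded M"
  shows "subgroup (loops M p S) (free_group S)"
proof (rule free.subgroupI)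
  have "[] \<in> loops M p S" by (simp add: loops_def carrier_free_group)
  then show "loops M p S \<noteq> {}" by blast
qed (auto simp: loops_def reads_inv reads_mult[OF assms])

text \<open>The words \<open>c q\<close> play the role of paths from \<open>p\<close> to the vertices \<open>q\<close>. Inserting
  \<open>c q\<inverse> c q\<close> at every vertex of a loop writes it as a product of the elements attached to its edges.\<close>
lemma loops_subset_subgroup:
  assumes K: "subgroup K (free_group S)"
    and c: "\<And>q. c q \<in> carrier (free_group S)" "c p = []"
    and edges: "\<And>q s r. (q, s, r) \<in> M \<Longrightarrow> s \<in> S \<Longrightarrow>
      c q \<otimes>\<^bsub>free_group S\<^esub> [(s, True)] \<otimes>\<^bsub>free_group S\<^esub> inv\<^bsub>free_group S\<^esub> c r \<in> K"
  shows "loops M p S \<subseteq> K"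
proof -
  let ?F = "free_group S"
  have step: "c q \<otimes>\<^bsub>?F\<^esub> [x] \<otimes>\<^bsub>?F\<^esub> inv\<^bsub>?F\<^esub> c r \<in> K" if x: "step M q x r" "fst x \<in> S" for q x r
  proof (cases "snd x")
    case True
    then show ?thesis using edges[of q "fst x" r] x by (cases x) (auto simp: step_def)
  next
    case False
    obtain s where s: "x = (s, False)" "s \<in> S" using False x(2) by (cases x) auto
    have "inv\<^bsub>?F\<^esub> (c r \<otimes>\<^bsub>?F\<^esub> [(s, True)] \<otimes>\<^bsub>?F\<^esub> inv\<^bsub>?F\<^esub> c q) \<in> K"
      using edges[of r s q] x s by (intro subgroup.m_inv_closed[OF K]) (auto simp: step_def)
    moreover have "inv\<^bsub>?F\<^esub> [(s, True)] = [x]" using s by (simp add: inv_free_group)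
    ultimately show ?thesis using c s by (simp add: free.inv_mult_group free.m_assoc)
  qed
  have "c q \<otimes>\<^bsub>?F\<^esub> w \<otimes>\<^bsub>?F\<^esub> inv\<^bsub>?F\<^esub> c r \<in> K" if "w \<in> carrier ?F" "reads M q w r" for q w r
    using that
  proof (induction w arbitrary: q)
    case Nil
    then show ?case using c subgroup.one_closed[OF K] by (simp flip: one_free_group[of S])
  next
    case (Cons x w)
    obtain t where t: "step M q x t" "reads M t w r" using Cons.prems by auto
    have x: "fst x \<in> S" "[x] \<in> carrier ?F" and w: "w \<in> carrier ?F" using Cons_in_free_group[OF Cons.prems(1)] by auto
    have "(c q \<otimes>\<^bsub>?F\<^esub> [x] \<otimes>\<^bsub>?F\<^esub> inv\<^bsub>?F\<^esub> c t) \<otimes>\<^bsub>?F\<^esub> (c t \<otimes>\<^bsub>?F\<^esub> w \<otimes>\<^bsub>?F\<^esub> inv\<^bsub>?F\<^esub> c r) \<in> K"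
      using step[OF t(1) x(1)] Cons.IH[OF w t(2)] by (rule subgroup.m_closed[OF K])
    moreover have "x # w = [x] \<otimes>\<^bsub>?F\<^esub> w" using Cons.prems by (intro Cons_eq_mult) (simp add: carrier_free_group)
    ultimately show ?case using c x w by (simp add: free.m_assoc)
  qed
  from this[of _ p p] show ?thesis using c by (auto simp: loops_def simp flip: one_free_group[of S])
qed

text \<open>Intersecting \<open>loops M p\<close> with a conjugate of \<open>loops M' p'\<close> amounts to looking at the product of the two
  graphs: a conjugate of \<open>h\<close> is readable as a loop in both graphs at once. The conjugator \<open>u\<close> is the
  longest prefix of \<open>g\<close> along which \<open>M\<close> can be followed from \<open>p\<close>, with \<open>h\<close> replaced by its conjugate at
  each step. When the next letter of \<open>g\<close> cannot be read, the remaining conjugation happens without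
  cancellation, so \<open>M'\<close> has to read the rest of \<open>g\<inverse>\<close> literally before it reads \<open>h\<close>.\<close>
lemma conjugate_loop_in_both:
  assumes M: "folded M" and M': "folded M'"
    and h: "h \<in> loops M p S" "h \<noteq> []" and g: "g \<in> carrier (free_group S)"
    and h': "inv\<^bsub>free_group S\<^esub> g \<otimes>\<^bsub>free_group S\<^esub> h \<otimes>\<^bsub>free_group S\<^esub> g \<in> loops M' p' S"
  shows "\<exists>u\<in>carrier (free_group S). \<exists>q q'. reads M p u q \<and> reads M' p' (inv\<^bsub>free_group S\<^esub> g \<otimes>\<^bsub>free_group S\<^esub> u) q' \<and>
    inv\<^bsub>free_group S\<^esub> u \<otimes>\<^bsub>free_group S\<^esub> h \<otimes>\<^bsub>free_group S\<^esub> u \<in> loops M q S \<inter> loops M' q' S"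
  using h g h'
proof (induction g arbitrary: p h)
  case Nil
  then show ?case
    by (intro bexI[of _ "[]"] exI[of _ p] exI[of _ p'])
      (auto simp: loops_def carrier_free_group simp flip: one_free_group[of S])
next
  case (Cons x g)
  let ?F = "free_group S"
  let ?inv = "\<lambda>w. inv\<^bsub>?F\<^esub> w"
  have h_in: "h \<in> carrier ?F" "reads M p h p" using Cons.prems by (auto simp: loops_def)
  have x: "fst x \<in> S" "[x] \<in> carrier ?F" and g: "g \<in> carrier ?F" using Cons_in_free_group[OF Cons.prems(3)] by auto
  have xg: "x # g = [x] \<otimes>\<^bsub>?F\<^esub> g" using Cons.prems by (intro Cons_eq_mult) (simp add: carrier_free_group)
  show ?case
  proof (cases "\<exists>r. step M p x r")
    case True
    then obtain r where r: "step M p x r" by blast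
    define k where "k = ?inv [x] \<otimes>\<^bsub>?F\<^esub> h \<otimes>\<^bsub>?F\<^esub> [x]"
    have k_in: "k \<in> carrier ?F" using h_in x by (simp add: k_def)
    have "reads M r k r"
      unfolding k_def using h_in x r by (intro reads_mult[OF M, of _ _ p]) (auto simp: reads_inv)
    then have k: "k \<in> loops M r S" using k_in by (simp add: loops_def)
    have "h = [x] \<otimes>\<^bsub>?F\<^esub> k \<otimes>\<^bsub>?F\<^esub> ?inv [x]" using h_in x by (simp add: k_def free.m_assoc)
    then have "k \<noteq> []" using Cons.prems(2) x by (auto simp flip: one_free_group[of S])
    moreover have "?inv g \<otimes>\<^bsub>?F\<^esub> k \<otimes>\<^bsub>?F\<^esub> g \<in> loops M' p' S"
      using Cons.prems(4) x g h_in by (simp add: xg k_def free.inv_mult_group free.m_assoc)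
    ultimately obtain u q q' where u: "u \<in> carrier ?F" "reads M r u q" "reads M' p' (?inv g \<otimes>\<^bsub>?F\<^esub> u) q'"
      "?inv u \<otimes>\<^bsub>?F\<^esub> k \<otimes>\<^bsub>?F\<^esub> u \<in> loops M q S \<inter> loops M' q' S"
      using Cons.IH[OF k _ g] by blast
    have "reads M p ([x] \<otimes>\<^bsub>?F\<^esub> u) q" using r u(2) by (intro reads_mult[OF M, of _ _ r]) auto
    moreover have "?inv (x # g) \<otimes>\<^bsub>?F\<^esub> ([x] \<otimes>\<^bsub>?F\<^esub> u) = ?inv g \<otimes>\<^bsub>?F\<^esub> u"
      using x g u(1) by (simp add: xg free.inv_mult_group free.m_assoc)
    moreover have "?inv ([x] \<otimes>\<^bsub>?F\<^esub> u) \<otimes>\<^bsub>?F\<^esub> h \<otimes>\<^bsub>?F\<^esub> ([x] \<otimes>\<^bsub>?F\<^esub> u) = ?inv u \<otimes>\<^bsub>?F\<^esub> k \<otimes>\<^bsub>?F\<^esub> u"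
      using x u(1) h_in by (simp add: k_def free.inv_mult_group free.m_assoc)
    ultimately show ?thesis using u x
      by (intro bexI[of _ "[x] \<otimes>\<^bsub>?F\<^esub> u"] exI[of _ q] exI[of _ q']) auto
  next
    case False
    have "hd h \<noteq> x" using h_in(2) False Cons.prems(2) by (cases h) auto
    moreover have "last h \<noteq> flip_letter x"
    proof
      assume "last h = flip_letter x"
      then obtain v where v: "h = v @ [flip_letter x]" using Cons.prems(2) by (metis append_butlast_last_id)
      obtain r where "step M r (flip_letter x) p"
        using h_in(2) unfolding v reads_append by (auto simp del: split_paired_All)
      then show False using False by (simp add: step_flip)
    qed
    ultimately have hd: "hd h \<noteq> flip_letter (flip_letter x)" and last: "x \<noteq> flip_letter (last h)"
      unfolding flip_flip using flip_flip[of "last h"] by auto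
    have "reduced_word (rev (map flip_letter (x # g)))"
      using Cons.prems(3) by (intro reduced_word_inverse) (simp add: carrier_free_group)
    moreover have "reduced_word h" "reduced_word (x # g)"
      using Cons.prems(3) h_in(1) by (simp_all add: carrier_free_group)
    ultimately have red: "reduced_word (rev (map flip_letter (x # g)) @ h @ x # g)"
      unfolding reduced_word_append using hd last Cons.prems(2) by simp
    have "?inv (x # g) \<otimes>\<^bsub>?F\<^esub> h = rev (map flip_letter (x # g)) @ h"
      unfolding inv_free_group[OF Cons.prems(3)]
      by (rule mult_eq_append) (use red reduced_word_append append_assoc in metis)
    then have "?inv (x # g) \<otimes>\<^bsub>?F\<^esub> h \<otimes>\<^bsub>?F\<^esub> (x # g) = rev (map flip_letter (x # g)) @ h @ x # g"
      using mult_eq_append[of "rev (map flip_letter (x # g)) @ h" "x # g" S] red by simp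
    then have "reads M' p' (rev (map flip_letter (x # g)) @ h @ x # g) p'"
      using Cons.prems(4) by (simp add: loops_def)
    then obtain q' r where q': "reads M' p' (rev (map flip_letter (x # g))) q'" "reads M' q' h r" "reads M' r (x # g) p'"
      unfolding reads_append by blast
    have "r = q'"
      using reads_deterministic[OF M' q'(1)] q'(3) reads_inverse[of M' p' "x # g" r] by simp
    moreover have "reads M' p' (?inv (x # g)) q'"
      using q'(1) unfolding inv_free_group[OF Cons.prems(3)] .
    ultimately show ?thesis using q'(2) h_in Cons.prems(3)
      by (intro bexI[of _ "\<one>\<^bsub>?F\<^esub>"] exI[of _ p] exI[of _ q']) (auto simp: loops_def)
  qed
qed

definition product_graph :: "('q, 'a) automaton \<Rightarrow> ('r, 'a) automaton \<Rightarrow> ('q \<times> 'r, 'a) automaton" where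
  "product_graph M M' = {((p, p'), s, (q, q')) | p p' s q q'. (p, s, q) \<in> M \<and> (p', s, q') \<in> M'}"

lemma step_product [simp]:
  "step (product_graph M M') (p, p') x (q, q') \<longleftrightarrow> step M p x q \<and> step M' p' x q'"
  by (auto simp: step_def product_graph_def)

lemma reads_product:
  "reads (product_graph M M') (p, p') w (q, q') \<longleftrightarrow> reads M p w q \<and> reads M' p' w q'"
  by (induction w arbitrary: p p') auto

lemma folded_product: "folded M \<Longrightarrow> folded M' \<Longrightarrow> folded (product_graph M M')"
  unfolding folded_def by (auto simp del: split_paired_All)

text \<open>In a graph where each vertex has at most one outgoing and at most one incoming label, the only way to
  change the direction of travel is to cancel a letter.\<close>
lemma one_sided_if_unbranched:
  assumes closed: "\<And>p x q. p \<in> U \<Longrightarrow> step M p x q \<Longrightarrow> q \<in> U"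
    and unbranched: "\<And>p x y q r. p \<in> U \<Longrightarrow> step M p x q \<Longrightarrow> step M p y r \<Longrightarrow> snd x = snd y \<Longrightarrow> fst x = fst y"
    and "reads M p w q" "p \<in> U" "reduced_word w"
  shows "successively (\<lambda>x y. snd x = snd y) w"
  using assms(3-)
proof (induction w arbitrary: p rule: induct_list012)
  case (3 x y w)
  then obtain r t where r: "step M p x r" "step M r y t" "reads M r (y # w) q" by auto
  have "r \<in> U" using closed r(1) 3 by blast
  have "snd x = snd y"
  proof (rule ccontr)
    assume "snd x \<noteq> snd y"
    then have "snd (flip_letter x) = snd y" by (cases x) auto
    moreover have "step M r (flip_letter x) p" using r(1) by (simp add: step_flip)
    ultimately have "fst (flip_letter x) = fst y" using unbranched \<open>r \<in> U\<close> r(2) by blast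
    then have "y = flip_letter x" using \<open>snd (flip_letter x) = snd y\<close> by (simp add: prod_eq_iff)
    then show False using 3 by (simp add: reduced_word_Cons)
  qed
  moreover have "reduced_word (y # w)" using 3 by (simp add: reduced_word_Cons)
  ultimately show ?case using 3 r \<open>r \<in> U\<close> by auto
qed auto

lemma loop_conj_exponent:
  assumes "u \<in> carrier (free_group S)" "h \<in> carrier (free_group S)" "h \<noteq> []"
  defines "k \<equiv> inv\<^bsub>free_group S\<^esub> u \<otimes>\<^bsub>free_group S\<^esub> h \<otimes>\<^bsub>free_group S\<^esub> u"
  shows "k \<noteq> []" "exponent f k = exponent f h"
proof -
  have "h = u \<otimes>\<^bsub>free_group S\<^esub> k \<otimes>\<^bsub>free_group S\<^esub> inv\<^bsub>free_group S\<^esub> u"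
    using assms(1,2) by (simp add: k_def free.m_assoc)
  then show "k \<noteq> []" using assms(1,3) by (auto simp flip: one_free_group[of S])
  show "exponent f k = exponent f h" using assms(1) by (simp add: k_def exponent_conj)
qed

text \<open>An element of the intersection of a subgroup with a conjugate of itself by an outside element gives
  a loop off the diagonal of the product of its Stallings graph with itself: equal vertices would put
  the conjugating element into the subgroup. If each off-diagonal component is a cycle all of whose
  edges point the same way round, or a line, such loops have nonzero exponent sum.\<close>
lemma exponent_off_diagonal:
  assumes M: "folded M"
    and unbranched: "\<And>p p' x y q q' r r'. \<lbrakk>p \<noteq> p'; step M p x q; step M p' x q'; step M p y r; step M p' y r';
      snd x = snd y\<rbrakk> \<Longrightarrow> fst x = fst y"
    and h: "h \<in> loops M p S" "h \<noteq> []" and g: "g \<in> carrier (free_group S)" "g \<notin> loops M p S"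
    and h': "inv\<^bsub>free_group S\<^esub> g \<otimes>\<^bsub>free_group S\<^esub> h \<otimes>\<^bsub>free_group S\<^esub> g \<in> loops M p S"
  shows "exponent (\<lambda>_. 1) h \<noteq> 0"
proof -
  let ?F = "free_group S"
  let ?inv = "\<lambda>w. inv\<^bsub>?F\<^esub> w"
  obtain u q q' where u: "u \<in> carrier ?F" "reads M p u q" "reads M p (?inv g \<otimes>\<^bsub>?F\<^esub> u) q'"
    and k: "?inv u \<otimes>\<^bsub>?F\<^esub> h \<otimes>\<^bsub>?F\<^esub> u \<in> loops M q S \<inter> loops M q' S"
    using conjugate_loop_in_both[OF M M h g(1) h'] by blast
  define k where "k = ?inv u \<otimes>\<^bsub>?F\<^esub> h \<otimes>\<^bsub>?F\<^esub> u"
  have "q \<noteq> q'"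
  proof
    assume "q = q'"
    then have "reads M p (u \<otimes>\<^bsub>?F\<^esub> ?inv (?inv g \<otimes>\<^bsub>?F\<^esub> u)) p"
      using u g by (intro reads_mult[OF M u(2)]) (simp add: reads_inv)
    moreover have "u \<otimes>\<^bsub>?F\<^esub> ?inv (?inv g \<otimes>\<^bsub>?F\<^esub> u) = g" using u g by (simp add: free.inv_mult_group)
    ultimately show False using g by (simp add: loops_def)
  qed
  have closed: "r \<noteq> r'" if "step M p x r" "step M p' x r'" "p \<noteq> p'" for p p' x r r'
    using that foldedD[OF M, of r "flip_letter x"] by (auto simp: step_flip)
  have reads_k: "reads (product_graph M M) (q, q') k (q, q')"
    using k[folded k_def] by (auto simp: loops_def reads_product)
  have reduced_k: "reduced_word k" using k[folded k_def] by (simp add: loops_def carrier_free_group)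
  have stays: "r \<in> {(p, p'). p \<noteq> p'}"
    if "p \<in> {(p, p'). p \<noteq> p'}" "step (product_graph M M) p x r" for p x r
    using that closed[of "fst p" x "fst r" "snd p" "snd r"] by (cases p; cases r) auto
  have "fst x = fst y"
    if "p \<in> {(p, p'). p \<noteq> p'}" "step (product_graph M M) p x q" "step (product_graph M M) p y r" "snd x = snd y"
    for p x y q r
    using that unbranched[of "fst p" "snd p" x "fst q" "snd q" y "fst r" "snd r"]
    by (cases p; cases q; cases r) auto
  with stays have "successively (\<lambda>x y. snd x = snd y) k"
    by (rule one_sided_if_unbranched[OF _ _ reads_k _ reduced_k]) (simp_all add: \<open>q \<noteq> q'\<close>)
  moreover have "h \<in> carrier ?F" using h by (simp add: loops_def)
  note conj = loop_conj_exponent[OF u(1) this h(2), folded k_def]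
  ultimately have "exponent (\<lambda>_. 1) k \<noteq> 0" using exponent_one_sided conj(1) by blast
  then show ?thesis unfolding conj(2) .
qed

section \<open>The subgroups generated by \<open>a, bab\<close> and by \<open>a\<^sup>2, b\<close>\<close>

declare One_nat_def [simp del]

abbreviation a_letter :: "nat \<times> bool" where "a_letter \<equiv> (0, True)"
abbreviation b_letter :: "nat \<times> bool" where "b_letter \<equiv> (1, True)"

definition graph_a_bab :: "(nat, nat) automaton" where
  "graph_a_bab = {(0, 0, 0), (0, 1, 1), (1, 0, 2), (2, 1, 0)}"

definition graph_aa_b :: "(nat, nat) automaton" where
  "graph_aa_b = {(0, 1, 0), (0, 0, 1), (1, 0, 0)}"

definition L_a_bab :: "nat word set" where "L_a_bab = loops graph_a_bab 0 {0, 1}"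
definition L_aa_b :: "nat word set" where "L_aa_b = loops graph_aa_b 0 {0, 1}"

lemma folded_a_bab: "folded graph_a_bab"
  by (auto simp: folded_def step_def graph_a_bab_def split: if_splits)

lemma folded_aa_b: "folded graph_aa_b"
  by (auto simp: folded_def step_def graph_aa_b_def split: if_splits)

lemma subgroup_L_a_bab: "subgroup L_a_bab F2"
  unfolding L_a_bab_def by (rule subgroup_loops[OF folded_a_bab])

lemma subgroup_L_aa_b: "subgroup L_aa_b F2"
  unfolding L_aa_b_def by (rule subgroup_loops[OF folded_aa_b])

text \<open>Off the diagonal, the product of the graph with itself consists of one cycle reading \<open>abab\<close> and of
  two isolated vertices.\<close>
lemma exponent_conj_a_bab:
  assumes "h \<in> L_a_bab" "h \<noteq> []" "g \<in> carrier F2" "g \<notin> L_a_bab"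
    "inv\<^bsub>F2\<^esub> g \<otimes>\<^bsub>F2\<^esub> h \<otimes>\<^bsub>F2\<^esub> g \<in> L_a_bab"
  shows "exponent (\<lambda>_. 1) h \<noteq> 0"
proof -
  have "fst x = fst y"
    if *: "p \<noteq> p'" "step graph_a_bab p x q" "step graph_a_bab p' x q'" "step graph_a_bab p y r"
      "step graph_a_bab p' y r'" "snd x = snd y" for p p' x y q q' r r'
  proof -
    have "p \<in> {0, 1, 2}" "p' \<in> {0, 1, 2}"
      using * by (auto simp: step_def graph_a_bab_def split: if_splits)
    then show ?thesis
      using * by (elim insertE emptyE; simp add: step_def graph_a_bab_def split: if_splits)
  qed
  then show ?thesis
    using assms unfolding L_a_bab_def by (intro exponent_off_diagonal[OF folded_a_bab])
qed

text \<open>Off the diagonal, the product of the graph with itself is one cycle reading \<open>a\<^sup>2\<close>.\<close>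
lemma exponent_conj_aa_b:
  assumes "h \<in> L_aa_b" "h \<noteq> []" "g \<in> carrier F2" "g \<notin> L_aa_b"
    "inv\<^bsub>F2\<^esub> g \<otimes>\<^bsub>F2\<^esub> h \<otimes>\<^bsub>F2\<^esub> g \<in> L_aa_b"
  shows "exponent (\<lambda>_. 1) h \<noteq> 0"
proof -
  have "fst x = fst y"
    if *: "p \<noteq> p'" "step graph_aa_b p x q" "step graph_aa_b p' x q'" "step graph_aa_b p y r"
      "step graph_aa_b p' y r'" "snd x = snd y" for p p' x y q q' r r'
  proof -
    have "p \<in> {0, 1}" "p' \<in> {0, 1}"
      using * by (auto simp: step_def graph_aa_b_def split: if_splits)
    then show ?thesis
      using * by (elim insertE emptyE; simp add: step_def graph_aa_b_def split: if_splits)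
  qed
  then show ?thesis
    using assms unfolding L_aa_b_def by (intro exponent_off_diagonal[OF folded_aa_b])
qed

text \<open>The product of the two graphs is connected and has a single cycle, which reads \<open>a\<^sup>2\<close> and runs
  through \<open>(0, 0)\<close> and \<open>(0, 1)\<close>. Leaving it by \<open>b\<close> or \<open>b\<inverse>\<close> at \<open>(0, 0)\<close> leads into a dead end of length
  two.\<close>
lemma product_core:
  assumes "reads (product_graph graph_a_bab graph_aa_b) (0, i) w (0, j)" "reduced_word w"
  shows "\<forall>x\<in>set w. fst x = 0"
  using assms
proof (induction w arbitrary: i)
  case (Cons x w)
  let ?P = "product_graph graph_a_bab graph_aa_b"
  obtain q q' where x: "step ?P (0, i) x (q, q')" and w: "reads ?P (q, q') w (0, j)" using Cons.prems by auto
  have red: "reduced_word w" using Cons.prems by (simp add: reduced_word_Cons)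
  show ?case
  proof (cases "fst x = 0")
    case True
    then have "q = 0" using x[unfolded step_product] by (auto simp: step_def graph_a_bab_def split: if_splits)
    then show ?thesis using Cons.IH[of q'] w red True by auto
  next
    case False
    then have q: "q = (if snd x then 1 else 2)" "q' = 0" "fst x = 1"
      using x[unfolded step_product] by (auto simp: step_def graph_a_bab_def graph_aa_b_def split: if_splits)
    then obtain y v where v: "w = y # v" using w by (cases w) (auto split: if_splits)
    then obtain t t' where y: "step ?P (q, q') y (t, t')" and t: "reads ?P (t, t') v (0, j)" using w by auto
    have "y \<noteq> flip_letter x" using Cons.prems v by (simp add: reduced_word_Cons)
    then have y_eq: "y = (0, snd x)" and t_eq: "t = (if snd x then 2 else 1)" "t' = 1"
      using y[unfolded step_product] q by (cases x; cases y; auto simp: step_def graph_a_bab_def graph_aa_b_def split: if_splits)+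
    obtain z v' where z: "v = z # v'" using t t_eq by (cases v) (auto split: if_splits)
    have "z \<noteq> flip_letter y" using red v z by (simp add: reduced_word_Cons)
    moreover obtain r r' where "step ?P (t, t') z (r, r')" using t z by auto
    then have "z = flip_letter y"
      unfolding step_product using t_eq y_eq by (cases z) (auto simp: step_def graph_a_bab_def graph_aa_b_def split: if_splits)
    ultimately show ?thesis by simp
  qed
qed simp

lemma one_letter_one_sided:
  "reduced_word w \<Longrightarrow> \<forall>x\<in>set w. fst x = s \<Longrightarrow> successively (\<lambda>x y. snd x = snd y) w"
  by (induction w rule: induct_list012) (auto simp: reduced_word_def inverse_letters_def)

text \<open>A common loop is conjugated along a path \<open>v\<close> to the base point \<open>(0, 0)\<close>, where reduced loops are powers of
  \<open>a\<close>.\<close>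
lemma exponent_conj_a_bab_aa_b:
  assumes h: "h \<in> L_a_bab" "h \<noteq> []" and g: "g \<in> carrier F2"
    and h': "inv\<^bsub>F2\<^esub> g \<otimes>\<^bsub>F2\<^esub> h \<otimes>\<^bsub>F2\<^esub> g \<in> L_aa_b"
  shows "exponent (\<lambda>_. 1) h \<noteq> 0"
proof -
  let ?P = "product_graph graph_a_bab graph_aa_b"
  let ?inv = "\<lambda>w. inv\<^bsub>F2\<^esub> w"
  have h_in: "h \<in> carrier F2" using h by (simp add: L_a_bab_def loops_def)
  obtain u q q' where u: "u \<in> carrier F2"
    and k: "?inv u \<otimes>\<^bsub>F2\<^esub> h \<otimes>\<^bsub>F2\<^esub> u \<in> loops graph_a_bab q {0, 1} \<inter> loops graph_aa_b q' {0, 1}"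
    using conjugate_loop_in_both[OF folded_a_bab folded_aa_b, of h 0 "{0, 1}" g 0] h g h'
    unfolding L_a_bab_def L_aa_b_def by blast
  define k where "k = ?inv u \<otimes>\<^bsub>F2\<^esub> h \<otimes>\<^bsub>F2\<^esub> u"
  have k_in: "k \<in> carrier F2" and k_ne: "k \<noteq> []" and k_exp: "exponent (\<lambda>_. 1) k = exponent (\<lambda>_. 1) h"
    using loop_conj_exponent[OF u h_in h(2)] u h_in by (auto simp: k_def)
  have reads_k: "reads ?P (q, q') k (q, q')" using k[folded k_def] by (auto simp: loops_def reads_product)
  then obtain x r r' where "step ?P (q, q') x (r, r')" using k_ne by (cases k) auto
  then have "q \<in> {0, 1, 2}" "q' \<in> {0, 1}"
    unfolding step_product by (auto simp: step_def graph_a_bab_def graph_aa_b_def split: if_splits)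
  \<comment> \<open>Labels of paths from \<open>(q, q')\<close> to \<open>(0, 0)\<close> in the product graph.\<close>
  define v where "v = (if q' = 0 then if q = 0 then [] else if q = 1 then [(1, False)] else [(1, True)]
     else if q = 0 then [(0, True)] else if q = 1 then [(0, True), (1, True)] else [(0, False), (1::nat, False)])"
  have v: "v \<in> carrier F2"
    by (auto simp: v_def carrier_free_group reduced_word_Cons)
  have "reads ?P (q, q') v (0, 0)"
    using \<open>q \<in> {0, 1, 2}\<close> \<open>q' \<in> {0, 1}\<close>
    unfolding reads_product v_def by (auto simp: step_def graph_a_bab_def graph_aa_b_def)
  then have "reads ?P (0, 0) (?inv v \<otimes>\<^bsub>F2\<^esub> k \<otimes>\<^bsub>F2\<^esub> v) (0, 0)"
    using reads_k v by (intro reads_mult[OF folded_product[OF folded_a_bab folded_aa_b], of _ _ "(q, q')"])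
      (auto simp: reads_inv)
  moreover have red: "reduced_word (?inv v \<otimes>\<^bsub>F2\<^esub> k \<otimes>\<^bsub>F2\<^esub> v)"
    using v k_in by (metis carrier_free_group free.inv_closed free.m_closed)
  ultimately have "successively (\<lambda>x y. snd x = snd y) (?inv v \<otimes>\<^bsub>F2\<^esub> k \<otimes>\<^bsub>F2\<^esub> v)"
    by (intro one_letter_one_sided[of _ 0] product_core)
  then show ?thesis using exponent_one_sided loop_conj_exponent[OF v k_in k_ne] k_exp by metis
qed

lemma cyclic_if_exponent_nonzero:
  assumes H: "subgroup H (free_group S)" and nz: "\<And>h. h \<in> H \<Longrightarrow> h \<noteq> [] \<Longrightarrow> exponent f h \<noteq> 0"
  shows "cyclic_group (free_group S\<lparr>carrier := H\<rparr>)"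
proof -
  interpret H: group "free_group S\<lparr>carrier := H\<rparr>" by (rule free.subgroup_imp_group[OF H])
  show ?thesis
    by (rule H.cyclic_group_if_int_valued[of "exponent f"]) (use nz in \<open>auto simp: exponent_mult one_free_group\<close>)
qed

definition pick :: "'b \<Rightarrow> 'b \<Rightarrow> nat \<Rightarrow> 'b" where
  "pick u v s = (if s = 0 then u else v)"

lemma pick_simps [simp]: "pick u v 0 = u" "pick u v 1 = v"
  by (simp_all add: pick_def)

lemma pick_in_carrier [simp]: "u \<in> carrier F2 \<Longrightarrow> v \<in> carrier F2 \<Longrightarrow> pick u v s \<in> carrier F2"
  by (simp add: pick_def)

lemma lift_pick_group_hom:
  assumes "\<And>s. f s \<in> carrier F2"
  shows "group_hom F2 F2 (lift F2 f)"
  using assms by (intro group_hom.intro group_hom_axioms.intro group_free_group free.lift_hom) auto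

lemma L_a_bab_eq: "L_a_bab = lift F2 (pick [a_letter] [b_letter, a_letter, b_letter]) ` carrier F2"
proof -
  define K where "K = lift F2 (pick [a_letter] [b_letter, a_letter, b_letter]) ` carrier F2"
  have bab: "[b_letter, a_letter, b_letter] \<in> carrier F2"
    by (simp add: carrier_free_group reduced_word_Cons)
  interpret l: group_hom F2 F2 "lift F2 (pick [a_letter] [b_letter, a_letter, b_letter])"
    by (rule lift_pick_group_hom) (use bab in auto)
  have K: "subgroup K F2" unfolding K_def by (rule l.img_is_subgroup)
  have gens: "[a_letter] \<in> K" "[b_letter, a_letter, b_letter] \<in> K" "[] \<in> K"
    using imageI[of "[a_letter]" "carrier F2" "lift F2 (pick [a_letter] [b_letter, a_letter, b_letter])"]
      imageI[of "[b_letter]" "carrier F2" "lift F2 (pick [a_letter] [b_letter, a_letter, b_letter])"]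
      bab subgroup.one_closed[OF K]
    by (simp_all add: lift_Cons flip: K_def) (simp add: one_free_group)
  define c where "c q = (if q = 1 then [b_letter] else if q = 2 then [b_letter, a_letter] else [])" for q :: nat
  have c: "c q \<in> carrier F2" for q
    by (auto simp: c_def carrier_free_group reduced_word_Cons)
  have "c q \<otimes>\<^bsub>F2\<^esub> [(s, True)] \<otimes>\<^bsub>F2\<^esub> inv\<^bsub>F2\<^esub> c r \<in> K" if "(q, s, r) \<in> graph_a_bab" for q s r
    using that gens unfolding inv_free_group[OF c] graph_a_bab_def
    by (elim insertE emptyE Pair_inject; simp add: c_def mult_free_group inverse_letters_def)
  moreover have "c 0 = []" by (simp add: c_def)
  ultimately have "L_a_bab \<subseteq> K"
    unfolding L_a_bab_def using loops_subset_subgroup[of K "{0, 1}" c 0 graph_a_bab] K c by blast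
  moreover have "pick [a_letter] [b_letter, a_letter, b_letter] s \<in> L_a_bab" if "s \<in> {0, 1}" for s
    using that bab by (auto simp: L_a_bab_def loops_def step_def graph_a_bab_def)
  then have "K \<subseteq> L_a_bab"
    unfolding K_def by (intro image_subsetI lift_in_subgroup[OF subgroup_L_a_bab]) (auto simp: carrier_free_group)
  ultimately show ?thesis unfolding K_def by blast
qed

lemma L_aa_b_eq: "L_aa_b = lift F2 (pick [a_letter, a_letter] [b_letter]) ` carrier F2"
proof -
  define K where "K = lift F2 (pick [a_letter, a_letter] [b_letter]) ` carrier F2"
  have aa: "[a_letter, a_letter] \<in> carrier F2"
    by (simp add: carrier_free_group reduced_word_Cons)
  interpret l: group_hom F2 F2 "lift F2 (pick [a_letter, a_letter] [b_letter])"
    by (rule lift_pick_group_hom) (use aa in auto)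
  have K: "subgroup K F2" unfolding K_def by (rule l.img_is_subgroup)
  have gens: "[a_letter, a_letter] \<in> K" "[b_letter] \<in> K" "[] \<in> K"
    using imageI[of "[a_letter]" "carrier F2" "lift F2 (pick [a_letter, a_letter] [b_letter])"]
      imageI[of "[b_letter]" "carrier F2" "lift F2 (pick [a_letter, a_letter] [b_letter])"]
      aa subgroup.one_closed[OF K]
    by (simp_all add: lift_Cons flip: K_def) (simp add: one_free_group)
  define c where "c q = (if q = 1 then [a_letter] else [])" for q :: nat
  have c: "c q \<in> carrier F2" for q
    by (auto simp: c_def carrier_free_group reduced_word_Cons)
  have "c q \<otimes>\<^bsub>F2\<^esub> [(s, True)] \<otimes>\<^bsub>F2\<^esub> inv\<^bsub>F2\<^esub> c r \<in> K" if "(q, s, r) \<in> graph_aa_b" for q s r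
    using that gens unfolding inv_free_group[OF c] graph_aa_b_def
    by (elim insertE emptyE Pair_inject; simp add: c_def mult_free_group inverse_letters_def)
  moreover have "c 0 = []" by (simp add: c_def)
  ultimately have "L_aa_b \<subseteq> K"
    unfolding L_aa_b_def using loops_subset_subgroup[of K "{0, 1}" c 0 graph_aa_b] K c by blast
  moreover have "pick [a_letter, a_letter] [b_letter] s \<in> L_aa_b" if "s \<in> {0, 1}" for s
    using that aa by (auto simp: L_aa_b_def loops_def step_def graph_aa_b_def)
  then have "K \<subseteq> L_aa_b"
    unfolding K_def by (intro image_subsetI lift_in_subgroup[OF subgroup_L_aa_b]) (auto simp: carrier_free_group)
  ultimately show ?thesis unfolding K_def by blast
qed

section \<open>The vertex and edge groups\<close>

lemma bab_in_F2: "[b_letter, a_letter, b_letter] \<in> carrier F2"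
  by (simp add: carrier_free_group reduced_word_Cons)

lemma aa_in_F2: "[a_letter, a_letter] \<in> carrier F2"
  by (simp add: carrier_free_group reduced_word_Cons)

abbreviation a_power :: "nat \<Rightarrow> nat word" where
  "a_power n \<equiv> replicate n a_letter"

lemma reduced_a_power: "reduced_word (a_power n)"
  by (induction n) (auto simp: reduced_word_Cons)

lemma a_power_in_F2 [simp]: "a_power n \<in> carrier F2"
  by (auto simp: carrier_free_group reduced_a_power)

lemma a_power_add: "a_power m \<otimes>\<^bsub>F2\<^esub> a_power n = a_power (m + n)"
  using mult_eq_append[of "a_power m" "a_power n" "{0, 1}"] reduced_a_power[of "m + n"]
  by (simp add: replicate_add)

lemma a_power_subgroup:
  assumes K: "subgroup K F2" and m: "a_power m \<in> K" "m dvd n"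
  shows "a_power n \<in> K"
proof -
  have "a_power (m * q) \<in> K" for q
  proof (induction q)
    case 0
    then show ?case using subgroup.one_closed[OF K] by (simp add: one_free_group)
  next
    case (Suc q)
    then show ?case using subgroup.m_closed[OF K m(1) Suc] by (simp add: a_power_add)
  qed
  then show ?thesis using m(2) by auto
qed

text \<open>\<open>basis N k 0\<close> and \<open>basis N k 1\<close> freely generate the vertex group of index \<open>k\<close>. If they are \<open>x\<close> and \<open>y\<close>, the edge
  group towards \<open>k + 1\<close> is generated by \<open>x, yxy\<close>. With \<open>x = x'\<^sup>2\<close> and \<open>y' = yxy\<close> it is the subgroup
  generated by \<open>x'\<^sup>2, y'\<close> in the next vertex group. The exponents of \<open>a\<close> are chosen to reach \<open>a\<close> itself
  at \<open>k = N\<close>.\<close>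
fun basis :: "nat \<Rightarrow> nat \<Rightarrow> nat \<Rightarrow> nat word" where
  "basis N 0 = pick (a_power (2 ^ N)) [b_letter]"
| "basis N (Suc k) =
     pick (a_power (2 ^ (N - Suc k))) (lift F2 (basis N k) [b_letter, a_letter, b_letter])"

text \<open>Identifies \<open>F2\<close> with the vertex group, so that all vertex groups look the same: the adjacent edge groups
  become \<open>L_a_bab\<close> (towards \<open>k + 1\<close>) and \<open>L_aa_b\<close> (towards \<open>k - 1\<close>).\<close>
definition embed :: "nat \<Rightarrow> nat \<Rightarrow> nat word \<Rightarrow> nat word" where
  "embed N k = lift F2 (basis N k)"

definition vertex_group :: "nat \<Rightarrow> nat \<Rightarrow> nat word set" where
  "vertex_group N k = embed N k ` carrier F2"

definition edge_group :: "nat \<Rightarrow> nat \<Rightarrow> nat word set" where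
  "edge_group N k = embed N k ` L_a_bab"

lemma basis_0: "basis N k 0 = a_power (2 ^ (N - k))"
  by (cases k) auto

lemma basis_Suc_1: "basis N (Suc k) 1 = embed N k [b_letter, a_letter, b_letter]"
  by (simp add: embed_def)

declare basis.simps(2) [simp del]

lemma basis_in_F2 [simp]: "basis N k s \<in> carrier F2"
proof (induction k arbitrary: s)
  case (Suc k)
  have "lift F2 (basis N k) [b_letter, a_letter, b_letter] \<in> carrier F2"
    by (rule free.lift_closed) (rule Suc)
  then show ?case by (simp add: basis.simps(2))
qed simp

lemma embed_group_hom: "group_hom F2 F2 (embed N k)"
  unfolding embed_def by (rule lift_pick_group_hom) simp

interpretation embed: group_hom F2 F2 "embed N k" for N k
  by (rule embed_group_hom)

lemma embed_letter [simp]: "embed N k [(s, True)] = basis N k s"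
  by (simp add: embed_def lift_Cons)

lemma basis_framed:
  assumes "s \<in> {0, 1}"
  shows "basis N k s \<noteq> [] \<and> hd (basis N k s) = (s, True) \<and> last (basis N k s) = (s, True)"
  using assms
proof (induction k arbitrary: s)
  case 0
  then show ?case by (auto simp: hd_replicate)
next
  case (Suc k)
  show ?case
  proof (cases "s = 0")
    case True
    then show ?thesis by (simp add: basis_0 hd_replicate)
  next
    case False
    then have "s = 1" using Suc.prems by simp
    have "lift F2 (basis N k) [b_letter, a_letter, b_letter] \<noteq> [] \<and>
      hd (lift F2 (basis N k) [b_letter, a_letter, b_letter]) = b_letter \<and>
      last (lift F2 (basis N k) [b_letter, a_letter, b_letter]) = b_letter"
      using lift_framed[of "{0, 1}" "basis N k", OF _ Suc.IH bab_in_F2] by simp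
    then show ?thesis by (simp add: \<open>s = 1\<close> basis.simps(2))
  qed
qed


lemma inj_embed: "inj_on (embed N k) (carrier F2)"
  unfolding embed.inj_on_one_iff
proof (intro allI impI, rule ccontr)
  fix w assume w: "w \<in> carrier F2" and one: "embed N k w = \<one>\<^bsub>F2\<^esub>" and "w \<noteq> \<one>\<^bsub>F2\<^esub>"
  then have "lift F2 (basis N k) w \<noteq> []"
    using lift_framed[of "{0, 1}" "basis N k" w] basis_framed by (auto simp: one_free_group)
  then show False using one by (simp add: embed_def one_free_group)
qed

lemma subgroup_vertex_group: "subgroup (vertex_group N k) F2"
  unfolding vertex_group_def by (rule embed.img_is_subgroup)

lemma subgroup_edge_group: "subgroup (edge_group N k) F2"
  unfolding edge_group_def by (rule embed.subgroup_img_is_subgroup[OF subgroup_L_a_bab])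

lemma basis_in_vertex_group: "s \<in> {0, 1} \<Longrightarrow> basis N k s \<in> vertex_group N k"
  using imageI[of "[(s, True)]" "carrier F2" "embed N k"] by (simp add: vertex_group_def)

lemma vertex_group_subset:
  assumes K: "subgroup K F2" and "basis N k 0 \<in> K" "basis N k 1 \<in> K"
  shows "vertex_group N k \<subseteq> K"
  unfolding vertex_group_def embed_def
  by (intro image_subsetI lift_in_subgroup[OF K]) (use assms in \<open>auto simp: carrier_free_group\<close>)

lemma embed_lift_image:
  assumes "\<And>s. f s \<in> carrier F2"
  shows "embed N k ` lift F2 f ` carrier F2 = lift F2 (pick (embed N k (f 0)) (embed N k (f 1))) ` carrier F2"
proof -
  have "embed N k (lift F2 f w) = lift F2 (pick (embed N k (f 0)) (embed N k (f 1))) w" if "w \<in> carrier F2" for w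
    unfolding hom_lift[OF embed_group_hom assms]
    by (rule lift_cong) (use that in \<open>auto simp: carrier_free_group\<close>)
  then show ?thesis by (auto simp: image_image)
qed

lemma edge_group_eq:
  "edge_group N k = lift F2 (pick (a_power (2 ^ (N - k))) (basis N (Suc k) 1)) ` carrier F2"
  unfolding edge_group_def L_a_bab_eq
  by (subst embed_lift_image) (simp_all add: bab_in_F2 basis_0 basis_Suc_1)

lemma edge_group_eq_upper:
  assumes "k < N"
  shows "edge_group N k = embed N (Suc k) ` L_aa_b"
proof -
  have "embed N (Suc k) [a_letter, a_letter] = basis N (Suc k) 0 \<otimes>\<^bsub>F2\<^esub> basis N (Suc k) 0"
    by (simp add: embed_def lift_Cons)
  also have "\<dots> = a_power (2 ^ (N - k))"
    using assms by (simp add: basis_0 a_power_add flip: power_Suc mult_2 Suc_diff_Suc)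
  finally show ?thesis
    unfolding edge_group_eq L_aa_b_eq
    by (subst embed_lift_image) (simp_all add: aa_in_F2)
qed

lemma edge_group_gens: "a_power (2 ^ (N - k)) \<in> edge_group N k" "basis N (Suc k) 1 \<in> edge_group N k"
proof -
  let ?f = "pick (a_power (2 ^ (N - k))) (basis N (Suc k) 1)"
  have "lift F2 ?f [(s, True)] \<in> edge_group N k" if "s \<in> {0, 1}" for s
    using that unfolding edge_group_eq by (intro imageI) simp
  from this[of 0] this[of 1] show "a_power (2 ^ (N - k)) \<in> edge_group N k" "basis N (Suc k) 1 \<in> edge_group N k"
    by (simp_all add: lift_Cons)
qed

lemma L_in_F2: "w \<in> L_a_bab \<Longrightarrow> w \<in> carrier F2" "w \<in> L_aa_b \<Longrightarrow> w \<in> carrier F2"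
  by (simp_all add: L_a_bab_def L_aa_b_def loops_def)

lemma edge_group_subset: "k < N \<Longrightarrow> edge_group N k \<subseteq> vertex_group N k \<inter> vertex_group N (Suc k)"
  using edge_group_eq_upper[of k N] L_in_F2 unfolding edge_group_def vertex_group_def by blast

definition a_exponent :: "nat word \<Rightarrow> int" where "a_exponent = exponent (pick 1 0)"
definition b_exponent :: "nat word \<Rightarrow> int" where "b_exponent = exponent (pick 0 1)"

lemma exponent_embed: "exponent f (embed N k w) = exponent (\<lambda>s. exponent f (basis N k s)) w"
  unfolding embed_def by (rule exponent_lift) simp

lemma a_exponent_a_power: "a_exponent (a_power n) = int n"
  unfolding a_exponent_def by (induction n) auto

lemma b_exponent_a_power: "b_exponent (a_power n) = 0"
  unfolding b_exponent_def by (induction n) auto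

lemma a_exponent_basis_1: "2 ^ (N - k) dvd a_exponent (basis N k 1)"
proof (induction k)
  case 0
  then show ?case by (simp add: a_exponent_def)
next
  case (Suc k)
  have "a_exponent (basis N (Suc k) 1) = 2 * a_exponent (basis N k 1) + 2 ^ (N - k)"
    using a_exponent_a_power[of "2 ^ (N - k)"]
    by (simp add: basis_Suc_1 a_exponent_def exponent_embed basis_0)
  moreover have "(2::int) ^ (N - Suc k) dvd 2 ^ (N - k)" by (rule le_imp_power_dvd) simp
  ultimately show ?case using Suc by (metis dvd_add dvd_mult dvd_trans)
qed

lemma b_exponent_basis_1: "b_exponent (basis N k 1) = 2 ^ k"
proof (induction k)
  case 0
  then show ?case by (simp add: b_exponent_def)
next
  case (Suc k)
  then show ?case using b_exponent_a_power[of "2 ^ (N - k)"]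
    by (simp add: basis_Suc_1 b_exponent_def exponent_embed basis_0)
qed

text \<open>These two divisibilities tell the groups of the chain apart up to conjugation, since exponent sums
  are invariant under conjugation.\<close>
lemma vertex_group_exponents:
  assumes "w \<in> vertex_group N k"
  shows "2 ^ (N - k) dvd a_exponent w" "2 ^ k dvd b_exponent w"
proof -
  obtain v where v: "w = embed N k v" "v \<in> carrier F2" using assms by (auto simp: vertex_group_def)
  have basis: "2 ^ (N - k) dvd a_exponent (basis N k s)" "2 ^ k dvd b_exponent (basis N k s)" if "s \<in> {0, 1}" for s
    using that a_exponent_basis_1[of N k] b_exponent_basis_1[of N k]
    by (auto simp: basis_0 a_exponent_a_power b_exponent_a_power)
  show "2 ^ (N - k) dvd a_exponent w" "2 ^ k dvd b_exponent w"
    unfolding v(1) a_exponent_def b_exponent_def exponent_embed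
    by (rule exponent_dvd; use v(2) basis in \<open>auto simp: a_exponent_def b_exponent_def carrier_free_group\<close>)+
qed

lemma subgroup_exponent_dvd: "subgroup {w \<in> carrier (free_group S). d dvd exponent f w} (free_group S)"
proof (rule free.subgroupI)
  show "{w \<in> carrier (free_group S). d dvd exponent f w} \<noteq> {}"
    using free.one_closed[of S] by (auto simp: one_free_group intro!: exI[of _ "[]"])
qed (auto simp: exponent_mult exponent_inv)

section \<open>The two sides of an edge\<close>

text \<open>The exponent sum of the final block of letters \<open>a\<close>. With \<open>H\<close> the subgroup generated by \<open>a\<^sup>n, b\<close>, the group \<open>F2\<close> is the
  amalgamated product of the powers of \<open>a\<close> with \<open>H\<close> along the powers of \<open>a\<^sup>n\<close>. On inverses \<open>w = g\<inverse>\<close> the two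
  sides of the base edge of its Bass-Serre tree are read off from \<open>trail w\<close> modulo \<open>n\<close>: left multiplication
  of \<open>w\<close> by \<open>b\<close> does not affect \<open>trail w\<close>, and left multiplication by \<open>a\<close> does so only if \<open>w\<close> is a power of \<open>a\<close>.\<close>
fun trail :: "nat word \<Rightarrow> int" where
  "trail [] = 0"
| "trail (x # w) = trail w + (if fst ` set (x # w) \<subseteq> {0} then if snd x then 1 else -1 else 0)"

definition is_a_power :: "nat word \<Rightarrow> bool" where
  "is_a_power w \<longleftrightarrow> fst ` set w \<subseteq> {0}"

lemma trail_cons_reduce_b: "fst x \<noteq> 0 \<Longrightarrow> trail (cons_reduce x w) = trail w"
  by (cases w) (auto simp: inverse_letters_def)

lemma trail_cons_reduce_a:
  assumes "fst x = 0"
  shows "is_a_power (cons_reduce x w) \<longleftrightarrow> is_a_power w"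
    "trail (cons_reduce x w) = trail w + (if is_a_power w then if snd x then 1 else -1 else 0)"
  using assms by (cases w; auto simp: inverse_letters_def is_a_power_def)+

lemma trail_a_power_mult: "trail (a_power m \<otimes>\<^bsub>F2\<^esub> w) = trail w + (if is_a_power w then int m else 0)"
proof -
  have "is_a_power (foldr cons_reduce (a_power m) w) \<longleftrightarrow> is_a_power w" for m
    by (induction m) (auto simp: trail_cons_reduce_a)
  then show ?thesis unfolding mult_free_group by (induction m) (auto simp: trail_cons_reduce_a)
qed

lemma is_a_power_in_subgroup:
  assumes K: "subgroup K F2" "a_power n \<in> K" and w: "w \<in> carrier F2" "is_a_power w" "int n dvd trail w"
  shows "w \<in> K"
proof -
  have "trail w = (if snd (hd w) then int (length w) else - int (length w)) \<and> w = replicate (length w) (0, snd (hd w))"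
    if "reduced_word w" "is_a_power w" "w \<noteq> []" for w
    using that
  proof (induction w)
    case (Cons x w)
    then show ?case
      by (cases w; cases x) (auto simp: reduced_word_Cons is_a_power_def prod_eq_iff)
  qed simp
  note form = this
  show ?thesis
  proof (cases "w = []")
    case True
    then show ?thesis using subgroup.one_closed[OF K(1)] by (simp add: one_free_group)
  next
    case False
    define m where "m = length w"
    have eq: "trail w = (if snd (hd w) then int m else - int m)" "w = replicate m (0, snd (hd w))"
      unfolding m_def using form[of w] w False by (simp_all add: carrier_free_group)
    have "n dvd m" using w(3) eq(1) by (auto split: if_splits)
    then have am: "a_power m \<in> K" using a_power_subgroup[OF K] by blast
    have "inv\<^bsub>F2\<^esub> (a_power m) = replicate m (0, False)" by (simp add: inv_free_group)
    then have "replicate m (0, e) \<in> K" for e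
      using am subgroup.m_inv_closed[OF K(1) am] by (cases e) auto
    then show ?thesis using eq(2) by metis
  qed
qed

text \<open>The elements whose left multiplication preserves \<open>trail\<close> modulo \<open>n\<close>; it contains \<open>a\<^sup>n\<close> and \<open>b\<close>.\<close>
definition trail_group :: "nat \<Rightarrow> nat word set" where
  "trail_group n = {h \<in> carrier F2. \<forall>w\<in>carrier F2. int n dvd trail (h \<otimes>\<^bsub>F2\<^esub> w) - trail w}"

lemma subgroup_trail_group: "subgroup (trail_group n) F2"
proof (rule free.subgroupI)
  show "trail_group n \<noteq> {}"
    using free.one_closed[of "{0, 1}"] by (auto simp: trail_group_def intro!: exI[of _ "\<one>\<^bsub>F2\<^esub>"])
  show "g \<otimes>\<^bsub>F2\<^esub> h \<in> trail_group n" if "g \<in> trail_group n" "h \<in> trail_group n" for g h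
  proof -
    have gh: "g \<in> carrier F2" "h \<in> carrier F2" using that by (auto simp: trail_group_def)
    have "int n dvd trail (g \<otimes>\<^bsub>F2\<^esub> h \<otimes>\<^bsub>F2\<^esub> w) - trail w" if w: "w \<in> carrier F2" for w
    proof -
      have "int n dvd (trail (g \<otimes>\<^bsub>F2\<^esub> (h \<otimes>\<^bsub>F2\<^esub> w)) - trail (h \<otimes>\<^bsub>F2\<^esub> w)) + (trail (h \<otimes>\<^bsub>F2\<^esub> w) - trail w)"
        using \<open>g \<in> trail_group n\<close> \<open>h \<in> trail_group n\<close> w gh by (intro dvd_add) (auto simp: trail_group_def)
      then show ?thesis using gh w by (simp add: free.m_assoc)
    qed
    then show ?thesis using gh by (simp add: trail_group_def)
  qed
  show "inv\<^bsub>F2\<^esub> g \<in> trail_group n" if "g \<in> trail_group n" for g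
  proof -
    have g: "g \<in> carrier F2" using that by (auto simp: trail_group_def)
    have "int n dvd trail (inv\<^bsub>F2\<^esub> g \<otimes>\<^bsub>F2\<^esub> w) - trail w" if w: "w \<in> carrier F2" for w
    proof -
      have "int n dvd trail (g \<otimes>\<^bsub>F2\<^esub> (inv\<^bsub>F2\<^esub> g \<otimes>\<^bsub>F2\<^esub> w)) - trail (inv\<^bsub>F2\<^esub> g \<otimes>\<^bsub>F2\<^esub> w)"
        using \<open>g \<in> trail_group n\<close> w g unfolding trail_group_def by blast
      then show ?thesis using g w by (simp add: dvd_diff_commute)
    qed
    then show ?thesis using g by (simp add: trail_group_def)
  qed
qed (auto simp: trail_group_def)

lemma a_power_in_trail_group: "n dvd m \<Longrightarrow> a_power m \<in> trail_group n"
  by (simp add: trail_group_def trail_a_power_mult)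

lemma b_in_trail_group: "[b_letter] \<in> trail_group n"
  by (simp add: trail_group_def mult_free_group trail_cons_reduce_b)

lemma vertex_group_subset_trail_group:
  assumes "k \<le> l"
  shows "vertex_group N k \<subseteq> trail_group (2 ^ (N - l))"
  using assms
proof (induction k)
  case 0
  show ?case
  proof (rule vertex_group_subset[OF subgroup_trail_group])
    show "basis N 0 1 \<in> trail_group (2 ^ (N - l))" using b_in_trail_group by simp
  qed (simp add: basis_0 a_power_in_trail_group le_imp_power_dvd del: basis.simps)
next
  case (Suc k)
  show ?case
  proof (rule vertex_group_subset[OF subgroup_trail_group])
    have "basis N (Suc k) 1 \<in> vertex_group N k"
      unfolding basis_Suc_1 vertex_group_def using bab_in_F2 by (rule imageI)
    then show "basis N (Suc k) 1 \<in> trail_group (2 ^ (N - l))" using Suc by auto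
    show "basis N (Suc k) 0 \<in> trail_group (2 ^ (N - l))"
      using Suc.prems by (simp add: basis_0 a_power_in_trail_group le_imp_power_dvd)
  qed
qed

text \<open>Put \<open>n = 2 ^ (N - k)\<close>. The vertex groups of index at most \<open>k\<close> lie in the subgroup \<open>H\<close> generated by \<open>a\<^sup>n, b\<close>, and
  those of larger index in the subgroup generated by \<open>a\<close> and the edge group \<open>C\<close>, where \<open>a\<^sup>n \<in> C \<subseteq> H\<close>. That \<open>F2\<close> is the
  amalgamated product of these two along \<open>C\<close> comes from folding the splitting of \<open>F2\<close> over the powers of
  \<open>a\<^sup>n\<close>: all translates of its base edge under \<open>C\<close> are identified. Accordingly, \<open>S\<close> is the union of the
  translates by \<open>C\<close> of the half \<open>\<not> n dvd trail (g\<inverse>)\<close>, and \<open>T = S \<union> C\<close>.\<close>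
lemma edge_halves:
  assumes k: "k < N"
  shows "\<exists>S T. (\<forall>j\<le>k. right_invariant F2 S (vertex_group N j)) \<and>
    (\<forall>j\<in>{k<..N}. right_invariant F2 T (vertex_group N j)) \<and>
    (\<forall>g\<in>carrier F2. (g \<in> S) \<noteq> (g \<in> T) \<longleftrightarrow> g \<in> edge_group N k)"
proof -
  define n where "n = (2::nat) ^ (N - k)"
  let ?C = "edge_group N k"
  have C: "subgroup ?C F2" by (rule subgroup_edge_group)
  have C_in: "c \<in> carrier F2" if "c \<in> ?C" for c using subgroup.mem_carrier[OF C that] .
  have C_trail: "?C \<subseteq> trail_group n"
    using edge_group_subset[OF k] vertex_group_subset_trail_group[of k k N] by (auto simp: n_def)
  define S where "S = {g \<in> carrier F2. \<exists>c\<in>?C. \<not> int n dvd trail (inv\<^bsub>F2\<^esub> g \<otimes>\<^bsub>F2\<^esub> c)}"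
  define T where "T = S \<union> ?C"
  have S_mult: "g \<otimes>\<^bsub>F2\<^esub> h \<in> S \<longleftrightarrow> g \<in> S" if g: "g \<in> carrier F2" and h: "h \<in> trail_group n" for g h
  proof -
    have hc: "h \<in> carrier F2" using h by (simp add: trail_group_def)
    have "inv\<^bsub>F2\<^esub> h \<in> trail_group n" using subgroup.m_inv_closed[OF subgroup_trail_group h] .
    then have "int n dvd trail (inv\<^bsub>F2\<^esub> h \<otimes>\<^bsub>F2\<^esub> (inv\<^bsub>F2\<^esub> g \<otimes>\<^bsub>F2\<^esub> c)) - trail (inv\<^bsub>F2\<^esub> g \<otimes>\<^bsub>F2\<^esub> c)"
      if "c \<in> ?C" for c
      using that C_in g by (simp add: trail_group_def)
    then have "int n dvd trail (inv\<^bsub>F2\<^esub> (g \<otimes>\<^bsub>F2\<^esub> h) \<otimes>\<^bsub>F2\<^esub> c) \<longleftrightarrow> int n dvd trail (inv\<^bsub>F2\<^esub> g \<otimes>\<^bsub>F2\<^esub> c)"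
      if "c \<in> ?C" for c
      using that C_in[OF that] g hc by (simp add: free.inv_mult_group free.m_assoc) (metis dvd_diff_right_iff diff_add_cancel dvd_add_right_iff)
    then show ?thesis using g hc by (auto simp: S_def)
  qed
  \<comment> \<open>\<open>T\<close> is the union of the translates by \<open>C\<close> of the same half enlarged by the powers of \<open>a\<close>;
    in this form right multiplication by \<open>a\<close> preserves it.\<close>
  have T_iff: "g \<in> T \<longleftrightarrow> (\<exists>c\<in>?C. is_a_power (inv\<^bsub>F2\<^esub> g \<otimes>\<^bsub>F2\<^esub> c) \<or> \<not> int n dvd trail (inv\<^bsub>F2\<^esub> g \<otimes>\<^bsub>F2\<^esub> c))"
    if g: "g \<in> carrier F2" for g
  proof
    assume "g \<in> T"
    moreover have "is_a_power (inv\<^bsub>F2\<^esub> g \<otimes>\<^bsub>F2\<^esub> g)" using g by (simp add: one_free_group is_a_power_def)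
    ultimately show "\<exists>c\<in>?C. is_a_power (inv\<^bsub>F2\<^esub> g \<otimes>\<^bsub>F2\<^esub> c) \<or> \<not> int n dvd trail (inv\<^bsub>F2\<^esub> g \<otimes>\<^bsub>F2\<^esub> c)"
      by (auto simp: T_def S_def)
  next
    assume "\<exists>c\<in>?C. is_a_power (inv\<^bsub>F2\<^esub> g \<otimes>\<^bsub>F2\<^esub> c) \<or> \<not> int n dvd trail (inv\<^bsub>F2\<^esub> g \<otimes>\<^bsub>F2\<^esub> c)"
    then obtain c where c: "c \<in> ?C"
      "is_a_power (inv\<^bsub>F2\<^esub> g \<otimes>\<^bsub>F2\<^esub> c) \<or> \<not> int n dvd trail (inv\<^bsub>F2\<^esub> g \<otimes>\<^bsub>F2\<^esub> c)" by blast
    show "g \<in> T"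
    proof (cases "int n dvd trail (inv\<^bsub>F2\<^esub> g \<otimes>\<^bsub>F2\<^esub> c)")
      case True
      then have "inv\<^bsub>F2\<^esub> g \<otimes>\<^bsub>F2\<^esub> c \<in> ?C"
        using is_a_power_in_subgroup[OF C, of n] edge_group_gens(1)[of N k] c g C_in by (auto simp: n_def)
      then have "c \<otimes>\<^bsub>F2\<^esub> inv\<^bsub>F2\<^esub> (inv\<^bsub>F2\<^esub> g \<otimes>\<^bsub>F2\<^esub> c) \<in> ?C"
        using c(1) subgroup.m_closed[OF C] subgroup.m_inv_closed[OF C] by blast
      then show ?thesis using g C_in[OF c(1)] by (simp add: T_def free.inv_mult_group)
    qed (use c g in \<open>auto simp: T_def S_def\<close>)
  qed
  \<comment> \<open>The right multiplications that preserve \<open>T\<close> form a subgroup, so it suffices to treat generators.\<close>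
  define R where "R = {h \<in> carrier F2. \<forall>g\<in>carrier F2. g \<otimes>\<^bsub>F2\<^esub> h \<in> T \<longleftrightarrow> g \<in> T}"
  have R: "subgroup R F2"
  proof (rule free.subgroupI)
    show "R \<noteq> {}" using free.one_closed[of "{0, 1}"] by (auto simp: R_def intro!: exI[of _ "\<one>\<^bsub>F2\<^esub>"])
    show "inv\<^bsub>F2\<^esub> h \<in> R" if "h \<in> R" for h
    proof -
      have h: "h \<in> carrier F2" using that by (simp add: R_def)
      have "g \<otimes>\<^bsub>F2\<^esub> inv\<^bsub>F2\<^esub> h \<in> T \<longleftrightarrow> g \<in> T" if g: "g \<in> carrier F2" for g
        using \<open>h \<in> R\<close> g h unfolding R_def
        by (auto simp: free.m_assoc dest!: bspec[of _ _ "g \<otimes>\<^bsub>F2\<^esub> inv\<^bsub>F2\<^esub> h"])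
      then show ?thesis using h by (simp add: R_def)
    qed
  qed (auto simp: R_def simp flip: free.m_assoc)
  have C_R: "?C \<subseteq> R"
  proof
    fix h assume h: "h \<in> ?C"
    have "g \<otimes>\<^bsub>F2\<^esub> h \<in> ?C \<longleftrightarrow> g \<in> ?C" if g: "g \<in> carrier F2" for g
    proof
      assume "g \<otimes>\<^bsub>F2\<^esub> h \<in> ?C"
      then have "g \<otimes>\<^bsub>F2\<^esub> h \<otimes>\<^bsub>F2\<^esub> inv\<^bsub>F2\<^esub> h \<in> ?C"
        using subgroup.m_inv_closed[OF C h] by (rule subgroup.m_closed[OF C])
      then show "g \<in> ?C" using g C_in[OF h] by (simp add: free.m_assoc)
    qed (use h subgroup.m_closed[OF C] in blast)
    then show "h \<in> R" using h C_trail C_in S_mult by (auto simp: R_def T_def)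
  qed
  have a_R: "[a_letter] \<in> R"
  proof -
    have "g \<otimes>\<^bsub>F2\<^esub> [a_letter] \<in> T \<longleftrightarrow> g \<in> T" if g: "g \<in> carrier F2" for g
    proof -
      have "inv\<^bsub>F2\<^esub> (g \<otimes>\<^bsub>F2\<^esub> [a_letter]) \<otimes>\<^bsub>F2\<^esub> c = cons_reduce (0, False) (inv\<^bsub>F2\<^esub> g \<otimes>\<^bsub>F2\<^esub> c)"
        if "c \<in> ?C" for c
      proof -
        have "inv\<^bsub>F2\<^esub> [a_letter] = [(0, False)]" by (simp add: inv_free_group)
        then show ?thesis using g C_in[OF that]
          by (simp add: free.inv_mult_group free.m_assoc) (simp add: mult_free_group)
      qed
      then show ?thesis using g by (auto simp: T_iff trail_cons_reduce_a)
    qed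
    then show ?thesis by (simp add: R_def)
  qed
  have aR: "a_power m \<in> R" for m
    using a_power_subgroup[OF R, of 1 m] a_R by (simp add: One_nat_def)
  have vertex_R: "vertex_group N j \<subseteq> R" if "k < j" for j
    using that
  proof (induction j)
    case (Suc j)
    have "basis N (Suc j) 1 \<in> R"
    proof (cases "k = j")
      case True
      then show ?thesis using edge_group_gens(2)[of N k] C_R by auto
    next
      case False
      then have "vertex_group N j \<subseteq> R" using Suc by auto
      then show ?thesis using bab_in_F2 by (auto simp: basis_Suc_1 vertex_group_def)
    qed
    then show ?case using aR by (intro vertex_group_subset[OF R]) (simp_all add: basis_0)
  qed simp
  have disjoint: "g \<notin> S" if g: "g \<in> ?C" for g
  proof -
    have "int n dvd trail (inv\<^bsub>F2\<^esub> g \<otimes>\<^bsub>F2\<^esub> c)" if c: "c \<in> ?C" for c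
    proof -
      have w: "inv\<^bsub>F2\<^esub> g \<otimes>\<^bsub>F2\<^esub> c \<in> trail_group n"
        using g c C_trail by (meson C subgroup.m_closed subgroup.m_inv_closed subsetD)
      then have "int n dvd trail (inv\<^bsub>F2\<^esub> g \<otimes>\<^bsub>F2\<^esub> c \<otimes>\<^bsub>F2\<^esub> \<one>\<^bsub>F2\<^esub>) - trail \<one>\<^bsub>F2\<^esub>"
        unfolding trail_group_def by blast
      then show ?thesis using w by (simp add: trail_group_def) (simp add: one_free_group)
    qed
    then show ?thesis by (simp add: S_def)
  qed
  show ?thesis
  proof (rule exI[of _ S], rule exI[of _ T], intro conjI ballI allI impI)
    show "right_invariant F2 S (vertex_group N j)" if "j \<le> k" for j
      using vertex_group_subset_trail_group[OF that, of N] S_mult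
      by (auto simp: right_invariant_def n_def)
    show "right_invariant F2 T (vertex_group N j)" if "j \<in> {k<..N}" for j
      using vertex_R[of j] that by (auto simp: right_invariant_def R_def)
    show "(g \<in> S) \<noteq> (g \<in> T) \<longleftrightarrow> g \<in> ?C" for g
      using disjoint by (auto simp: T_def)
  qed
qed

section \<open>The tree\<close>

text \<open>Sets of words cannot be encoded injectively by natural numbers, but words can; so a coset is encoded
  by a chosen representative.\<close>
definition coset_code :: "nat \<Rightarrow> nat \<Rightarrow> nat word \<Rightarrow> nat" where
  "coset_code N i g = to_nat (i, SOME h. h \<in> carrier F2 \<and> inv\<^bsub>F2\<^esub> g \<otimes>\<^bsub>F2\<^esub> h \<in> vertex_group N i)"

lemma coset_code_eq_iff:
  assumes g: "g \<in> carrier F2" and h: "h \<in> carrier F2"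
  shows "coset_code N i g = coset_code N j h \<longleftrightarrow> i = j \<and> inv\<^bsub>F2\<^esub> g \<otimes>\<^bsub>F2\<^esub> h \<in> vertex_group N i"
proof -
  have K: "subgroup (vertex_group N i) F2" for i by (rule subgroup_vertex_group)
  define rep where "rep i g = (SOME h. h \<in> carrier F2 \<and> inv\<^bsub>F2\<^esub> g \<otimes>\<^bsub>F2\<^esub> h \<in> vertex_group N i)" for i g
  have rep: "rep i g \<in> carrier F2" "inv\<^bsub>F2\<^esub> g \<otimes>\<^bsub>F2\<^esub> rep i g \<in> vertex_group N i" if "g \<in> carrier F2" for g i
    using someI[of "\<lambda>h. h \<in> carrier F2 \<and> inv\<^bsub>F2\<^esub> g \<otimes>\<^bsub>F2\<^esub> h \<in> vertex_group N i" g]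
      that subgroup.one_closed[OF K] by (auto simp: rep_def)
  have "rep i g = rep i h \<longleftrightarrow> inv\<^bsub>F2\<^esub> g \<otimes>\<^bsub>F2\<^esub> h \<in> vertex_group N i"
  proof
    assume eq: "rep i g = rep i h"
    have "inv\<^bsub>F2\<^esub> g \<otimes>\<^bsub>F2\<^esub> rep i g \<otimes>\<^bsub>F2\<^esub> inv\<^bsub>F2\<^esub> (inv\<^bsub>F2\<^esub> h \<otimes>\<^bsub>F2\<^esub> rep i h) \<in> vertex_group N i"
      by (rule subgroup.m_closed[OF K rep(2)[OF g] subgroup.m_inv_closed[OF K rep(2)[OF h]]])
    then show "inv\<^bsub>F2\<^esub> g \<otimes>\<^bsub>F2\<^esub> h \<in> vertex_group N i"
      using g h rep(1)[OF h, of i] unfolding eq by (simp add: free.inv_mult_group free.m_assoc)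
  next
    assume gh: "inv\<^bsub>F2\<^esub> g \<otimes>\<^bsub>F2\<^esub> h \<in> vertex_group N i"
    have "inv\<^bsub>F2\<^esub> g \<otimes>\<^bsub>F2\<^esub> k \<in> vertex_group N i \<longleftrightarrow> inv\<^bsub>F2\<^esub> h \<otimes>\<^bsub>F2\<^esub> k \<in> vertex_group N i"
      if k: "k \<in> carrier F2" for k
    proof -
      have "inv\<^bsub>F2\<^esub> g \<otimes>\<^bsub>F2\<^esub> k = inv\<^bsub>F2\<^esub> g \<otimes>\<^bsub>F2\<^esub> h \<otimes>\<^bsub>F2\<^esub> (inv\<^bsub>F2\<^esub> h \<otimes>\<^bsub>F2\<^esub> k)"
        "inv\<^bsub>F2\<^esub> h \<otimes>\<^bsub>F2\<^esub> k = inv\<^bsub>F2\<^esub> (inv\<^bsub>F2\<^esub> g \<otimes>\<^bsub>F2\<^esub> h) \<otimes>\<^bsub>F2\<^esub> (inv\<^bsub>F2\<^esub> g \<otimes>\<^bsub>F2\<^esub> k)"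
        using g h k by (simp_all add: free.inv_mult_group free.m_assoc)
      then show ?thesis using gh subgroup.m_closed[OF K] subgroup.m_inv_closed[OF K gh] by metis
    qed
    then show "rep i g = rep i h" unfolding rep_def by meson
  qed
  then show ?thesis by (auto simp: coset_code_def simp flip: rep_def)
qed

lemma F2_chain: "subgroup_chain F2 N (vertex_group N) (edge_group N) (coset_code N)"
proof (intro subgroup_chain.intro subgroup_chain_axioms.intro group_free_group)
  show "carrier F2 \<subseteq> generate F2 (\<Union>i\<le>N. vertex_group N i)"
  proof (rule free_group_subset_subgroup)
    have sub: "(\<Union>i\<le>N. vertex_group N i) \<subseteq> carrier F2"
      using subgroup.subset[OF subgroup_vertex_group] by blast
    show "subgroup (generate F2 (\<Union>i\<le>N. vertex_group N i)) F2"
      by (rule free.generate_is_subgroup[OF sub])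
    have "[a_letter] \<in> vertex_group N N"
      using basis_in_vertex_group[of 0 N N] by (simp add: basis_0 One_nat_def)
    moreover have "[b_letter] \<in> vertex_group N 0"
      using basis_in_vertex_group[of 1 N 0] by simp
    ultimately show "[(s, True)] \<in> generate F2 (\<Union>i\<le>N. vertex_group N i)" if "s \<in> {0, 1}" for s
      using that by (auto intro!: generate.incl)
  qed
  show "\<exists>S T. (\<forall>j\<le>i. right_invariant F2 S (vertex_group N j)) \<and>
    (\<forall>j\<in>{i<..N}. right_invariant F2 T (vertex_group N j)) \<and>
    (\<forall>g\<in>carrier F2. (g \<in> S) \<noteq> (g \<in> T) \<longleftrightarrow> g \<in> edge_group N i)" if "i < N" for i
    using that by (rule edge_halves)
qed (auto simp: subgroup_vertex_group subgroup_edge_group coset_code_eq_iff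
    dest: edge_group_subset[THEN subsetD])

text \<open>Via \<open>embed\<close> the claim becomes one about \<open>L_a_bab\<close> and \<open>L_aa_b\<close> in \<open>F2\<close>: in each of the four cases the
  exponent sum is injective on the intersection, which is therefore cyclic.\<close>
lemma edges_meet_in_cyclic_groups:
  assumes "j < N" "k < N" "i \<in> {j, Suc j}" "i \<in> {k, Suc k}" and u: "u \<in> vertex_group N i"
    and distinct: "j \<noteq> k \<or> u \<notin> edge_group N j"
    and H: "subgroup H F2" "H \<subseteq> edge_group N j"
    and conj: "\<And>h. h \<in> H \<Longrightarrow> inv\<^bsub>F2\<^esub> u \<otimes>\<^bsub>F2\<^esub> h \<otimes>\<^bsub>F2\<^esub> u \<in> edge_group N k"
  shows "cyclic_group (F2\<lparr>carrier := H\<rparr>)"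
proof -
  define L where "L j = (if i = j then L_a_bab else L_aa_b)" for j
  have edge: "edge_group N m = embed N i ` L m" if "m < N" "i \<in> {m, Suc m}" for m
    using that edge_group_eq_upper[of m N] by (auto simp: L_def edge_group_def)
  have L_in: "w \<in> carrier F2" if "w \<in> L m" for w m using that L_in_F2 by (auto simp: L_def split: if_splits)
  have mem: "w \<in> L m" if "embed N i w \<in> edge_group N m" "w \<in> carrier F2" "m < N" "i \<in> {m, Suc m}" for w m
    using that edge[of m] L_in inj_embed[of N i] by (auto dest: inj_onD)
  obtain v where v: "v \<in> carrier F2" "u = embed N i v" using u by (auto simp: vertex_group_def)
  define K where "K = {w \<in> carrier F2. embed N i w \<in> H}"
  have K: "subgroup K F2"
  proof (rule free.subgroupI)
    show "K \<noteq> {}"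
      using subgroup.one_closed[OF H(1)] by (auto simp: K_def intro!: exI[of _ "\<one>\<^bsub>F2\<^esub>"])
  qed (use subgroup.m_closed[OF H(1)] subgroup.m_inv_closed[OF H(1)] in \<open>auto simp: K_def\<close>)
  have "exponent (\<lambda>_. 1) h \<noteq> 0" if h: "h \<in> K" "h \<noteq> []" for h
  proof -
    have h_in: "h \<in> carrier F2" "h \<in> L j" using h H(2) assms(1,3) mem by (auto simp: K_def)
    have h': "inv\<^bsub>F2\<^esub> v \<otimes>\<^bsub>F2\<^esub> h \<otimes>\<^bsub>F2\<^esub> v \<in> L k"
      using conj[of "embed N i h"] h v h_in assms(2,4) by (intro mem) (auto simp: K_def)
    have "j \<noteq> k \<or> v \<notin> L j" using distinct v edge[OF assms(1,3)] by auto
    then consider "L j = L_a_bab" "L k = L_a_bab" "v \<notin> L_a_bab" | "L j = L_aa_b" "L k = L_aa_b" "v \<notin> L_aa_b" |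
      "L j = L_a_bab" "L k = L_aa_b" | "L j = L_aa_b" "L k = L_a_bab"
      using assms(3,4) by (auto simp: L_def split: if_splits)
    then show ?thesis
    proof cases
      case 1
      then show ?thesis using exponent_conj_a_bab h(2) h_in h' v(1) by metis
    next
      case 2
      then show ?thesis using exponent_conj_aa_b h(2) h_in h' v(1) by metis
    next
      case 3
      then show ?thesis using exponent_conj_a_bab_aa_b h(2) h_in h' v(1) by metis
    next
      case 4
      \<comment> \<open>Conjugating by \<open>v\<inverse>\<close> instead exchanges the two subgroups.\<close>
      let ?h' = "inv\<^bsub>F2\<^esub> v \<otimes>\<^bsub>F2\<^esub> h \<otimes>\<^bsub>F2\<^esub> v"
      have "inv\<^bsub>F2\<^esub> (inv\<^bsub>F2\<^esub> v) \<otimes>\<^bsub>F2\<^esub> ?h' \<otimes>\<^bsub>F2\<^esub> inv\<^bsub>F2\<^esub> v = h"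
        using v(1) h_in(1) by (simp add: free.m_assoc)
      then have "exponent (\<lambda>_. 1) ?h' \<noteq> 0"
        using 4 h' h_in v(1) loop_conj_exponent(1)[OF v(1) h_in(1) h(2)]
        by (intro exponent_conj_a_bab_aa_b[of _ "inv\<^bsub>F2\<^esub> v"]) auto
      then show ?thesis using exponent_conj[OF v(1)] by metis
    qed
  qed
  then have "cyclic_group (F2\<lparr>carrier := K\<rparr>)" by (rule cyclic_if_exponent_nonzero[OF K])
  moreover have "embed N i ` K = H"
    using H(2) edge[OF assms(1,3)] L_in by (auto simp: K_def)
  then have "embed N i \<in> epi (F2\<lparr>carrier := K\<rparr>) (F2\<lparr>carrier := H\<rparr>)"
    using embed.hom_mult by (auto simp: epi_def hom_def K_def)
  ultimately show ?thesis
    using group.cyclic_group_epimorphic_image[OF free.subgroup_imp_group[OF K]] free.subgroup_imp_group[OF H(1)]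
    by blast
qed

text \<open>The subgroups for minimality are those of even exponent sum in \<open>a\<close> and in \<open>b\<close>. A vertex group of index \<open>i\<close>
  contains elements with exponent sums \<open>2 ^ (N - i)\<close> in \<open>a\<close> and \<open>2 ^ i\<close> in \<open>b\<close>, while those of an edge group of
  index \<open>j\<close> are divisible by \<open>2 ^ (N - j)\<close> and \<open>2 ^ (j + 1)\<close>; so they are conjugate for no \<open>i\<close> and \<open>j\<close>.\<close>
theorem theorem3p3:
  fixes N :: nat
  assumes "N > 0"
  shows "\<exists>(V :: nat set) (E :: nat set set) (\<phi> :: nat word \<Rightarrow> nat \<Rightarrow> nat).
           tree_action F2 V E \<phi> \<and> reduced_tree F2 V E \<phi> \<and>
           acylindrical_on V E \<phi> 1 (noncyclic_subgroups F2) \<and>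
           card (edge_orbits F2 E \<phi>) = N"
proof -
  interpret subgroup_chain F2 N "vertex_group N" "edge_group N" "coset_code N"
    by (rule F2_chain)
  have a: "\<not> 2 dvd a_exponent [a_letter]" and b: "\<not> 2 dvd b_exponent [b_letter]"
    by (simp_all add: a_exponent_def b_exponent_def)
  have minimal: "minimal_action F2 V E act"
  proof (rule minimal_action[OF assms])
    fix i assume i: "i < N"
    have "subgroup {w \<in> carrier F2. 2 dvd a_exponent w} F2"
      unfolding a_exponent_def by (rule subgroup_exponent_dvd)
    moreover have "2 dvd a_exponent w" if "w \<in> vertex_group N j" "j \<le> i" for w j
    proof -
      have "(2::int) dvd 2 ^ (N - j)" using that i by (intro dvd_power) auto
      then show ?thesis using vertex_group_exponents(1)[OF that(1)] by (rule dvd_trans)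
    qed
    moreover have "[a_letter] \<notin> {w \<in> carrier F2. 2 dvd a_exponent w}" "[a_letter] \<in> carrier F2" using a by auto
    ultimately show "\<exists>L. subgroup L F2 \<and> (\<Union>j\<le>i. vertex_group N j) \<subseteq> L \<and> L \<noteq> carrier F2"
      using subgroup.mem_carrier[OF subgroup_vertex_group]
      by (intro exI[of _ "{w \<in> carrier F2. 2 dvd a_exponent w}"]) blast
    have "subgroup {w \<in> carrier F2. 2 dvd b_exponent w} F2"
      unfolding b_exponent_def by (rule subgroup_exponent_dvd)
    moreover have "2 dvd b_exponent w" if "w \<in> vertex_group N j" "i < j" for w j
    proof -
      have "(2::int) dvd 2 ^ j" using that by (intro dvd_power) auto
      then show ?thesis using vertex_group_exponents(2)[OF that(1)] by (rule dvd_trans)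
    qed
    moreover have "[b_letter] \<notin> {w \<in> carrier F2. 2 dvd b_exponent w}" "[b_letter] \<in> carrier F2" using b by auto
    ultimately show "\<exists>L. subgroup L F2 \<and> (\<Union>j\<in>{i<..N}. vertex_group N j) \<subseteq> L \<and> L \<noteq> carrier F2"
      using subgroup.mem_carrier[OF subgroup_vertex_group]
      by (intro exI[of _ "{w \<in> carrier F2. 2 dvd b_exponent w}"] conjI) (blast | force)+
  qed
  have "reduced_tree F2 V E act"
  proof (rule reduced_tree[OF minimal], rule notI)
    fix i j g h
    assume ij: "i \<le> N" "j < N" and g: "g \<in> carrier F2" and h: "h \<in> carrier F2"
      and eq: "{x \<in> carrier F2. inv\<^bsub>F2\<^esub> g \<otimes>\<^bsub>F2\<^esub> x \<otimes>\<^bsub>F2\<^esub> g \<in> vertex_group N i} =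
        {x \<in> carrier F2. inv\<^bsub>F2\<^esub> h \<otimes>\<^bsub>F2\<^esub> x \<otimes>\<^bsub>F2\<^esub> h \<in> edge_group N j}"
    have transfer: "2 ^ (N - j) dvd a_exponent w" "2 ^ Suc j dvd b_exponent w" if w: "w \<in> vertex_group N i" for w
    proof -
      have w_in: "w \<in> carrier F2" using subgroup.mem_carrier[OF subgroup_vertex_group w] .
      define x where "x = g \<otimes>\<^bsub>F2\<^esub> w \<otimes>\<^bsub>F2\<^esub> inv\<^bsub>F2\<^esub> g"
      have x: "x \<in> carrier F2" "inv\<^bsub>F2\<^esub> g \<otimes>\<^bsub>F2\<^esub> x \<otimes>\<^bsub>F2\<^esub> g = w"
        using g w_in by (simp_all add: x_def free.m_assoc)
      then have "inv\<^bsub>F2\<^esub> h \<otimes>\<^bsub>F2\<^esub> x \<otimes>\<^bsub>F2\<^esub> h \<in> edge_group N j" using eq w by blast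
      then have y: "inv\<^bsub>F2\<^esub> h \<otimes>\<^bsub>F2\<^esub> x \<otimes>\<^bsub>F2\<^esub> h \<in> vertex_group N j \<inter> vertex_group N (Suc j)"
        using edge_group_subset[OF ij(2)] by blast
      have "exponent f (inv\<^bsub>F2\<^esub> h \<otimes>\<^bsub>F2\<^esub> x \<otimes>\<^bsub>F2\<^esub> h) = exponent f w" for f
        using exponent_conj[OF g, of f x] exponent_conj[OF h, of f x] x(2) by simp
      then show "2 ^ (N - j) dvd a_exponent w" "2 ^ Suc j dvd b_exponent w"
        using vertex_group_exponents[of _ N j] vertex_group_exponents[of _ N "Suc j"] y
        unfolding a_exponent_def b_exponent_def by (metis IntD1, metis IntD2)
    qed
    have "(2::int) ^ (N - j) dvd 2 ^ (N - i)"
      using transfer(1)[OF basis_in_vertex_group[of 0]] by (simp add: basis_0 a_exponent_a_power)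
    moreover have "(2::int) ^ Suc j dvd 2 ^ i"
      using transfer(2)[OF basis_in_vertex_group[of 1]] by (simp add: b_exponent_basis_1 del: power_Suc)
    ultimately have "N - j \<le> N - i" "Suc j \<le> i"
      using dvd_power_iff[of "2::int" "N - j" "N - i"] dvd_power_iff[of "2::int" "Suc j" i] by auto
    then show False using ij by linarith
  qed
  moreover have "acylindrical_on V E act 1 (noncyclic_subgroups F2)"
    by (rule acylindrical_noncyclic) (rule edges_meet_in_cyclic_groups)
  ultimately show ?thesis using tree_action card_edge_orbits by blast
qed

end
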